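(* The ILP consistency problem for $\mathcal{G}^*$ is decidable in polynomial time.
   Context: Clauses are finite disjunctions of first-order literals, treated as sets of literals. A signed relation name is a relation name together with the polarity of a literal in which it occurs. A clause is straight if no signed relation name occurs in it twice. $\phi \vdash \psi$ ($\theta$-subsumption) means there is a variable substitution $\theta$ with $\phi\theta\subseteq\psi$. A clause $C$ is guarded if there is a literal $G\in C$ such that every variable of $C$ occurs in $G$. The ILP consistency problem for $\mathcal{G}^*$: given a finite set $E^+$ of straight ground clauses and a finite set $E^-$ of ground clauses, decide whether there exists a function-free guarded clause $H$ with $H \vdash C$ for all $C\in E^+$, $H\not\vdash C$ for all $C \in E^-$, and $\{H\}$ consistent. *)

theory Defs
  imports "HOL-Computational_Algebra.Polynomial"
begin

section \<open>Clauses and subsumption\<close>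

text \<open>Symbols are finite words over a two-letter alphabet, so that there are infinitely many of
  them and an input is charged for the length of the names that occur in it.\<close>

type_synonym name = "bool list"

datatype trm = Var name | Fun name "trm list"

datatype literal = Lit (pos: bool) (rel: name) (args: "trm list")

type_synonym clause = "literal set"

fun trm_vars :: "trm \<Rightarrow> name set" where
  "trm_vars (Var x) = {x}"
| "trm_vars (Fun f ts) = (\<Union>t\<in>set ts. trm_vars t)"

definition lit_vars :: "literal \<Rightarrow> name set" where
  "lit_vars L = (\<Union>t\<in>set (args L). trm_vars t)"

definition clause_vars :: "clause \<Rightarrow> name set" where
  "clause_vars C = (\<Union>L\<in>C. lit_vars L)"

definition ground :: "clause \<Rightarrow> bool" where
  "ground C \<longleftrightarrow> clause_vars C = {}"

text \<open>Constants are the function symbols of arity 0; they are permitted in function-free clauses.\<close>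

fun function_free_trm :: "trm \<Rightarrow> bool" where
  "function_free_trm (Var x) = True"
| "function_free_trm (Fun f ts) = (ts = [])"

definition function_free :: "clause \<Rightarrow> bool" where
  "function_free C \<longleftrightarrow> (\<forall>L\<in>C. \<forall>t\<in>set (args L). function_free_trm t)"

text \<open>A relation name comes with an arity: the same word used with different numbers of
  arguments stands for different relation names.\<close>

definition signed_rel :: "literal \<Rightarrow> bool \<times> name \<times> nat" where
  "signed_rel L = (pos L, rel L, length (args L))"

definition straight :: "clause \<Rightarrow> bool" where
  "straight C \<longleftrightarrow> inj_on signed_rel C"

definition guarded :: "clause \<Rightarrow> bool" where
  "guarded C \<longleftrightarrow> (\<exists>G\<in>C. clause_vars C \<subseteq> lit_vars G)"

primrec subst_trm :: "(name \<Rightarrow> trm) \<Rightarrow> trm \<Rightarrow> trm" where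
  "subst_trm \<theta> (Var x) = \<theta> x"
| "subst_trm \<theta> (Fun f ts) = Fun f (map (subst_trm \<theta>) ts)"

definition subst_lit :: "(name \<Rightarrow> trm) \<Rightarrow> literal \<Rightarrow> literal" where
  "subst_lit \<theta> L = Lit (pos L) (rel L) (map (subst_trm \<theta>) (args L))"

definition subsumes :: "clause \<Rightarrow> clause \<Rightarrow> bool" (infix "\<turnstile>" 50) where
  "C \<turnstile> D \<longleftrightarrow> (\<exists>\<theta>. subst_lit \<theta> ` C \<subseteq> D)"

section \<open>Consistency\<close>

primrec trm_value :: "(name \<Rightarrow> 'u list \<Rightarrow> 'u) \<Rightarrow> (name \<Rightarrow> 'u) \<Rightarrow> trm \<Rightarrow> 'u" where
  "trm_value F v (Var x) = v x"
| "trm_value F v (Fun f ts) = F f (map (trm_value F v) ts)"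

definition lit_true ::
  "(name \<Rightarrow> 'u list \<Rightarrow> 'u) \<Rightarrow> (name \<Rightarrow> 'u list \<Rightarrow> bool) \<Rightarrow> (name \<Rightarrow> 'u) \<Rightarrow> literal \<Rightarrow> bool" where
  "lit_true F R v L \<longleftrightarrow> (R (rel L) (map (trm_value F v) (args L)) \<longleftrightarrow> pos L)"

text \<open>A set of (universally quantified) clauses is consistent if it has a model.  By the
  Loewenheim--Skolem theorem it is enough to consider models whose universe \<open>U\<close> is a
  set of natural numbers.\<close>

definition consistent :: "clause set \<Rightarrow> bool" where
  "consistent S \<longleftrightarrow>
     (\<exists>(U :: nat set) F R. U \<noteq> {} \<and> (\<forall>f us. set us \<subseteq> U \<longrightarrow> F f us \<in> U) \<and>
        (\<forall>C\<in>S. \<forall>v. range v \<subseteq> U \<longrightarrow> (\<exists>L\<in>C. lit_true F R v L)))"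

section \<open>The ILP consistency problem\<close>

definition ilp_instance :: "clause set \<Rightarrow> clause set \<Rightarrow> bool" where
  "ilp_instance Ep En \<longleftrightarrow>
     finite Ep \<and> finite En \<and>
     (\<forall>C\<in>Ep. finite C \<and> ground C \<and> straight C) \<and>
     (\<forall>C\<in>En. finite C \<and> ground C)"

definition ilp_consistent :: "clause set \<Rightarrow> clause set \<Rightarrow> bool" where
  "ilp_consistent Ep En \<longleftrightarrow>
     (\<exists>H. finite H \<and> function_free H \<and> guarded H \<and>
          (\<forall>C\<in>Ep. H \<turnstile> C) \<and> (\<forall>C\<in>En. \<not> H \<turnstile> C) \<and> consistent {H})"

section \<open>Polynomial time\<close>

text \<open>The machine model is the language WHILE of Jones (Computability and Complexity from a
  Programming Perspective, 1997).  Its values are unlabelled binary trees, programs use finitely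
  many variables, and every elementary operation costs one unit.  Trees may share subtrees, so
  \<open>ConsE\<close>, \<open>HdE\<close>, \<open>TlE\<close> and assignment are pointer operations; the problems that WHILE programs
  decide in polynomial time are exactly those in the Turing machine class PTIME.\<close>

datatype tree = Leaf | Node tree tree

datatype expr = NilE | V nat | ConsE expr expr | HdE expr | TlE expr

datatype com =
    Skip
  | Assign nat expr
  | Seq com com
  | Cond expr com com
  | While expr com

type_synonym state = "nat \<Rightarrow> tree"

fun left :: "tree \<Rightarrow> tree" where
  "left Leaf = Leaf"
| "left (Node l r) = l"

fun right :: "tree \<Rightarrow> tree" where
  "right Leaf = Leaf"
| "right (Node l r) = r"

primrec eval_expr :: "expr \<Rightarrow> state \<Rightarrow> tree" where
  "eval_expr NilE s = Leaf"
| "eval_expr (V i) s = s i"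
| "eval_expr (ConsE a b) s = Node (eval_expr a s) (eval_expr b s)"
| "eval_expr (HdE a) s = left (eval_expr a s)"
| "eval_expr (TlE a) s = right (eval_expr a s)"

primrec cost :: "expr \<Rightarrow> nat" where
  "cost NilE = 1"
| "cost (V i) = 1"
| "cost (ConsE a b) = cost a + cost b + 1"
| "cost (HdE a) = cost a + 1"
| "cost (TlE a) = cost a + 1"

text \<open>\<open>exec c s t s'\<close>: started in state \<open>s\<close>, program \<open>c\<close> halts after \<open>t\<close> time units in
  state \<open>s'\<close>.  \<open>Leaf\<close> plays the role of false, every other tree that of true.\<close>

inductive exec :: "com \<Rightarrow> state \<Rightarrow> nat \<Rightarrow> state \<Rightarrow> bool" where
  Skip: "exec Skip s 1 s"
| Assign: "exec (Assign i e) s (cost e + 1) (s(i := eval_expr e s))"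
| Seq: "exec c s t s' \<Longrightarrow> exec d s' u s'' \<Longrightarrow> exec (Seq c d) s (t + u + 1) s''"
| CondTrue: "eval_expr e s \<noteq> Leaf \<Longrightarrow> exec c s t s' \<Longrightarrow> exec (Cond e c d) s (cost e + t + 1) s'"
| CondFalse: "eval_expr e s = Leaf \<Longrightarrow> exec d s t s' \<Longrightarrow> exec (Cond e c d) s (cost e + t + 1) s'"
| WhileFalse: "eval_expr e s = Leaf \<Longrightarrow> exec (While e c) s (cost e + 1) s"
| WhileTrue: "eval_expr e s \<noteq> Leaf \<Longrightarrow> exec c s t s' \<Longrightarrow> exec (While e c) s' u s'' \<Longrightarrow>
    exec (While e c) s (cost e + t + u + 1) s''"

lemma exec_deterministic:
  "exec c s t s' \<Longrightarrow> exec c s u s'' \<Longrightarrow> t = u \<and> s' = s''"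
proof (induction arbitrary: u s'' rule: exec.induct)
  case (Skip s)
  then show ?case by cases auto
next
  case (Assign i e s)
  then show ?case by cases auto
next
  case (Seq c s t s' d w r)
  from Seq.prems show ?case by cases (metis Seq.IH)
next
  case (CondTrue e s c t s' d)
  from CondTrue.prems show ?case by cases (metis CondTrue.hyps(1) CondTrue.IH)+
next
  case (CondFalse e s d t s' c)
  from CondFalse.prems show ?case by cases (metis CondFalse.hyps(1) CondFalse.IH)+
next
  case (WhileFalse e s c)
  from WhileFalse.prems show ?case by cases (simp_all add: WhileFalse.hyps)
next
  case (WhileTrue e s c t s' w r)
  from WhileTrue.prems show ?case
  proof cases
    case WhileFalse
    with WhileTrue.hyps show ?thesis by simp
  next
    case (WhileTrue t' m u')
    then show ?thesis by (metis WhileTrue.IH)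
  qed
qed

definition initial :: "tree \<Rightarrow> state" where
  "initial x = (\<lambda>_. Leaf)(0 := x)"

text \<open>Decidability in polynomial time of the decision problem with instances \<open>I\<close>, coded by
  \<open>code\<close>, and property \<open>Y\<close>.  The size of a tree is its number of inner nodes.\<close>

definition poly_time_decidable :: "('i \<Rightarrow> tree) \<Rightarrow> 'i set \<Rightarrow> ('i \<Rightarrow> bool) \<Rightarrow> bool" where
  "poly_time_decidable code I Y \<longleftrightarrow>
     (\<exists>(c :: com) (p :: nat poly). \<forall>x\<in>I. \<exists>t s.
        exec c (initial (code x)) t s \<and> t \<le> poly p (size (code x)) \<and> (s 0 \<noteq> Leaf \<longleftrightarrow> Y x))"

section \<open>Coding of instances\<close>

text \<open>An instance is presented to a program by listing the clauses, and the literals of each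
  clause, in an arbitrary order and possibly with repetitions.\<close>

type_synonym presentation = "literal list list \<times> literal list list"

definition clauses :: "literal list list \<Rightarrow> clause set" where
  "clauses Cs = set ` set Cs"

definition code_list :: "tree list \<Rightarrow> tree" where
  "code_list ts = foldr Node ts Leaf"

definition code_bool :: "bool \<Rightarrow> tree" where
  "code_bool b = (if b then Node Leaf Leaf else Leaf)"

definition code_name :: "name \<Rightarrow> tree" where
  "code_name w = code_list (map code_bool w)"

primrec code_trm :: "trm \<Rightarrow> tree" where
  "code_trm (Var x) = Node (code_bool False) (code_name x)"
| "code_trm (Fun f ts) = Node (code_bool True) (Node (code_name f) (code_list (map code_trm ts)))"

definition code_lit :: "literal \<Rightarrow> tree" where
  "code_lit L =
     Node (code_bool (pos L)) (Node (code_name (rel L)) (code_list (map code_trm (args L))))"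

definition code_clauses :: "literal list list \<Rightarrow> tree" where
  "code_clauses Cs = code_list (map (\<lambda>C. code_list (map code_lit C)) Cs)"

definition code_presentation :: "presentation \<Rightarrow> tree" where
  "code_presentation = (\<lambda>(Ps, Ns). Node (code_clauses Ps) (code_clauses Ns))"

lemma inj_code_list: "inj code_list"
proof (rule injI)
  fix xs ys assume "code_list xs = code_list ys"
  then show "xs = ys"
  proof (induction xs arbitrary: ys)
    case Nil
    then show ?case by (cases ys) (auto simp: code_list_def)
  next
    case (Cons x xs)
    then show ?case by (cases ys) (auto simp: code_list_def)
  qed
qed

lemma inj_code_bool: "inj code_bool"
  by (rule injI) (simp add: code_bool_def split: if_splits)

lemma inj_code_name: "inj code_name"
proof -
  have "inj (code_list \<circ> map code_bool)"
    by (intro inj_compose inj_code_list inj_mapI inj_code_bool)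
  then show ?thesis
    by (simp add: code_name_def [abs_def] comp_def)
qed

lemma inj_code_trm: "inj code_trm"
proof (rule injI)
  fix t u show "code_trm t = code_trm u \<Longrightarrow> t = u"
  proof (induction t arbitrary: u)
    case (Var x)
    then show ?case
      by (cases u) (simp_all add: code_bool_def inj_eq [OF inj_code_name])
  next
    case (Fun f ts)
    from Fun.prems obtain us where u: "u = Fun f us" and eq: "map code_trm ts = map code_trm us"
      by (cases u)
        (simp_all add: code_bool_def inj_eq [OF inj_code_name] inj_eq [OF inj_code_list])
    from eq have "length ts = length us"
      by (rule map_eq_imp_length_eq)
    moreover have "ts ! i = us ! i" if "i < length ts" for i
    proof (rule Fun.IH)
      show "ts ! i \<in> set ts" using that by simp
      show "code_trm (ts ! i) = code_trm (us ! i)"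
        using that eq \<open>length ts = length us\<close> by (metis nth_map)
    qed
    ultimately have "ts = us"
      by (simp add: nth_equalityI)
    with u show ?case by simp
  qed
qed

lemma inj_code_lit: "inj code_lit"
proof (rule injI)
  fix L M assume "code_lit L = code_lit M"
  then show "L = M"
    by (cases L; cases M)
      (simp add: code_lit_def inj_eq [OF inj_code_bool] inj_eq [OF inj_code_name]
        inj_eq [OF inj_code_list] inj_map_eq_map [OF inj_code_trm])
qed

lemma inj_code_presentation: "inj code_presentation"
proof -
  have "inj (code_list \<circ> map (code_list \<circ> map code_lit))"
    by (intro inj_compose inj_code_list inj_mapI inj_code_lit)
  then have "inj code_clauses"
    by (simp add: code_clauses_def [abs_def] comp_def)
  then show ?thesis
    by (auto simp: inj_def code_presentation_def)
qed

end

theory Submission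
  imports Defs
begin

text \<open>Because the positive examples are straight, a clause that subsumes all of them has at most one
  image literal for each signed relation name in each example. Once the signed relation name of
  the guard is fixed, there is therefore a most specific candidate: the least general
  generalizations of the literals whose signed relation name is common to all positive examples,
  restricted to those whose variables occur in the generalized guard. Its variables are determined
  by equality of columns, where a column collects the terms at one argument position in all
  positive examples. It subsumes a negative example iff, for some image of the guard in that
  example (which determines the substitution), every other literal is mapped into the example.
  This criterion uses only quantifiers over the literals and argument positions of the input and
  equality tests of terms, and such formulas are evaluated by nested loops in polynomial time.\<close>

section \<open>Polynomial bounds and running times\<close>

text \<open>Without straightness, generalizing m examples multiplies their literals, and the
  candidate can grow exponentially in m. Straightness leaves one literal per signed relation name.
  Keeping only literals whose variables lie in the guard loses nothing: in a function-free guarded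
  clause \<open>H\<close>, each variable is itself an argument of the guard, so its column is
  already a column of the guard's image. Hence a negative example subsumed by the candidate for that
  guard is subsumed by \<open>H\<close> as well. Consistency holds because a guarded clause is
  nonempty, and a single nonempty clause has a model. With no positive example there is no candidate
  to build; a literal with a fresh relation name then solves the instance. The formula language
  separates this criterion from programming: a fixed formula becomes a loop nest of fixed depth, and
  polynomial bounds survive the products and compositions caused by nesting.\<close>

definition poly_bounded :: "(nat \<Rightarrow> nat) \<Rightarrow> bool" where
  "poly_bounded f \<longleftrightarrow> (\<exists>p. \<forall>n. f n \<le> poly p n)"

text \<open>Natural coefficients exclude cancellation. Monotonicity is what carries a bound on an
  inner function through an outer one in \<open>poly_bounded_compose\<close>.\<close>

lemma poly_mono_nat:
  fixes p :: "nat poly"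
  assumes "m \<le> n"
  shows "poly p m \<le> poly p n"
  by (induction p) (auto intro: add_mono mult_mono assms)

lemma poly_bounded_const: "poly_bounded (\<lambda>_. k)"
  unfolding poly_bounded_def by (rule exI [of _ "[:k:]"]) simp

lemma poly_bounded_id: "poly_bounded (\<lambda>n. n)"
  unfolding poly_bounded_def by (rule exI [of _ "[:0, 1:]"]) simp

lemma poly_bounded_add:
  assumes "poly_bounded f" "poly_bounded g"
  shows "poly_bounded (\<lambda>n. f n + g n)"
  using assms unfolding poly_bounded_def by (metis add_mono poly_add)

lemma poly_bounded_mult:
  assumes "poly_bounded f" "poly_bounded g"
  shows "poly_bounded (\<lambda>n. f n * g n)"
  using assms unfolding poly_bounded_def by (metis mult_le_mono poly_mult)

lemma poly_bounded_compose:
  assumes "poly_bounded f" "poly_bounded g"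
  shows "poly_bounded (\<lambda>n. f (g n))"
  using assms unfolding poly_bounded_def by (metis order_trans poly_mono_nat poly_pcompose)

lemmas poly_bounded_intros =
  poly_bounded_add poly_bounded_mult poly_bounded_const poly_bounded_id

text \<open>A total-correctness triple with a time budget. \<open>T\<close> is only an upper bound,
  so it can be rounded up; since \<open>exec\<close> is deterministic, the existing run is the only
  one.\<close>

definition runs :: "com \<Rightarrow> state \<Rightarrow> nat \<Rightarrow> (state \<Rightarrow> bool) \<Rightarrow> bool" where
  "runs c s T Q \<longleftrightarrow> (\<exists>t s'. exec c s t s' \<and> t \<le> T \<and> Q s')"

lemma runs_mono:
  assumes "runs c s T Q" "T \<le> T'" "\<And>s'. Q s' \<Longrightarrow> Q' s'"
  shows "runs c s T' Q'"
  using assms unfolding runs_def by (meson order_trans)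

lemma runs_SeqI:
  assumes "runs c s T (\<lambda>s'. runs d s' U Q)" "T + U + 1 \<le> M"
  shows "runs (Seq c d) s M Q"
proof -
  obtain t s' u s'' where "exec c s t s'" "t \<le> T" "exec d s' u s''" "u \<le> U" "Q s''"
    using assms(1) unfolding runs_def by blast
  then show ?thesis using assms(2) unfolding runs_def
    by (intro exI [of _ "t + u + 1"] exI [of _ s'']) (auto intro: exec.Seq [simplified])
qed

text \<open>\<open>m\<close> bounds the number of remaining iterations, each paying for one test and
  one body. The extra 1 in \<open>M + 1\<close> covers the final, failing test.\<close>

lemma runs_While:
  assumes step: "\<And>s. I s \<Longrightarrow> eval_expr b s \<noteq> Leaf \<Longrightarrow> runs c s K (\<lambda>s'. I s' \<and> m s' < (m s :: nat))"
    and init: "I s"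
    and exit: "\<And>s'. I s' \<Longrightarrow> eval_expr b s' = Leaf \<Longrightarrow> Q s'"
    and le: "m s \<le> M"
  shows "runs (While b c) s ((M + 1) * (cost b + K + 1)) Q"
  using init le
proof (induction M arbitrary: s rule: less_induct)
  case (less M)
  show ?case
  proof (cases "eval_expr b s = Leaf")
    case True
    with exit less.prems(1) show ?thesis unfolding runs_def
      by (intro exI [of _ "cost b + 1"] exI [of _ s]) (auto intro: exec.WhileFalse [simplified])
  next
    case False
    obtain t s' where *: "exec c s t s'" "t \<le> K" "I s'" "m s' < m s"
      using step [OF less.prems(1) False] unfolding runs_def by blast
    then obtain M' where M: "M = Suc M'" "m s' \<le> M'"
      using less.prems(2) by (cases M) auto
    obtain u s'' where u: "exec (While b c) s' u s''" "u \<le> (M' + 1) * (cost b + K + 1)" "Q s''"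
      using less.IH [of M' s'] * M unfolding runs_def by blast
    have "exec (While b c) s (cost b + t + u + 1) s''"
      using False *(1) u(1) by (rule exec.WhileTrue)
    moreover have "cost b + t + u + 1 \<le> (M + 1) * (cost b + K + 1)"
      using M(1) *(2) u(2) by simp
    ultimately show ?thesis using u(3) unfolding runs_def by blast
  qed
qed

section \<open>Symbolic execution of loop-free commands\<close>

inductive_cases exec_SkipE: "exec Skip s t s'"
inductive_cases exec_AssignE: "exec (Assign i e) s t s'"
inductive_cases exec_SeqE: "exec (Seq c d) s t s'"
inductive_cases exec_CondE: "exec (Cond e c d) s t s'"

lemma runs_Skip_iff: "runs Skip s T Q \<longleftrightarrow> 1 \<le> T \<and> Q s"
proof
  assume "runs Skip s T Q"
  then show "1 \<le> T \<and> Q s" unfolding runs_def by (elim exE conjE exec_SkipE) simp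
next
  assume "1 \<le> T \<and> Q s"
  then show "runs Skip s T Q" unfolding runs_def using exec.Skip by blast
qed

lemma runs_Assign_iff: "runs (Assign i e) s T Q \<longleftrightarrow> cost e + 1 \<le> T \<and> Q (s(i := eval_expr e s))"
proof
  assume "runs (Assign i e) s T Q"
  then show "cost e + 1 \<le> T \<and> Q (s(i := eval_expr e s))"
    unfolding runs_def by (elim exE conjE exec_AssignE) simp
next
  assume "cost e + 1 \<le> T \<and> Q (s(i := eval_expr e s))"
  then show "runs (Assign i e) s T Q" unfolding runs_def using exec.Assign by blast
qed

lemma runs_Seq_Assign_iff:
  "runs (Seq (Assign i e) d) s T Q \<longleftrightarrow>
     cost e + 2 \<le> T \<and> runs d (s(i := eval_expr e s)) (T - (cost e + 2)) Q"
proof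
  assume "runs (Seq (Assign i e) d) s T Q"
  then obtain t s' where *: "exec (Seq (Assign i e) d) s t s'" "t \<le> T" "Q s'"
    unfolding runs_def by blast
  from *(1) obtain u where "exec d (s(i := eval_expr e s)) u s'" "t = cost e + 1 + u + 1"
    by (elim exec_SeqE exec_AssignE) simp
  with *(2,3) show "cost e + 2 \<le> T \<and> runs d (s(i := eval_expr e s)) (T - (cost e + 2)) Q"
    unfolding runs_def by (intro conjI exI [of _ u] exI [of _ s']) simp_all
next
  assume "cost e + 2 \<le> T \<and> runs d (s(i := eval_expr e s)) (T - (cost e + 2)) Q"
  then show "runs (Seq (Assign i e) d) s T Q"
    by (intro runs_SeqI [where T = "cost e + 1" and U = "T - (cost e + 2)"])
      (auto simp: runs_Assign_iff)
qed

lemma runs_Seq_AssignI: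
  assumes "runs d s' U Q" "s' = s(i := eval_expr e s)"
  shows "runs (Seq (Assign i e) d) s (cost e + 2 + U) Q"
  using assms by (simp add: runs_Seq_Assign_iff)

lemma runs_Cond_iff:
  "runs (Cond e c d) s T Q \<longleftrightarrow>
     cost e + 1 \<le> T \<and> runs (if eval_expr e s = Leaf then d else c) s (T - (cost e + 1)) Q"
  (is "?l \<longleftrightarrow> ?r")
proof
  assume ?l
  then obtain t s' where *: "exec (Cond e c d) s t s'" "t \<le> T" "Q s'"
    unfolding runs_def by blast
  from *(1) obtain u where "exec (if eval_expr e s = Leaf then d else c) s u s'" "t = cost e + u + 1"
    by (elim exec_CondE) simp_all
  with *(2,3) show ?r
    unfolding runs_def by (intro conjI exI [of _ u] exI [of _ s']) simp_all
next
  assume r: ?r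
  then obtain t s' where *:
    "exec (if eval_expr e s = Leaf then d else c) s t s'" "t \<le> T - (cost e + 1)" "Q s'"
    unfolding runs_def by blast
  have "exec (Cond e c d) s (cost e + t + 1) s'"
    using *(1) by (auto split: if_splits intro: exec.CondFalse [simplified] exec.CondTrue [simplified])
  moreover have "cost e + t + 1 \<le> T"
    using *(2) r by linarith
  ultimately show ?l using *(3) unfolding runs_def by blast
qed

lemmas runs_simps = runs_Skip_iff runs_Assign_iff runs_Seq_Assign_iff runs_Cond_iff

section \<open>First-order formulas over trees\<close>

primrec len :: "tree \<Rightarrow> nat" where
  "len Leaf = 0"
| "len (Node a b) = Suc (len b)"

primrec unary :: "nat \<Rightarrow> tree" where
  "unary 0 = Leaf"
| "unary (Suc n) = Node Leaf (unary n)"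

lemma len_unary [simp]: "len (unary n) = n"
  by (induction n) auto

lemma size_unary [simp]: "size (unary n) = n"
  by (induction n) auto

lemma len_le_size: "len t \<le> size t"
  by (induction t) auto

lemma size_left: "size (left t) \<le> size t"
  by (cases t) auto

lemma size_right: "size (right t) \<le> size t"
  by (cases t) auto

lemma size_right_funpow: "size ((right ^^ k) t) \<le> size t"
  by (induction k) (auto intro: order_trans [OF size_right])

text \<open>Index quantifiers range over unary numbers below the length of a list, so that one index can
  be used to address several lists.\<close>

datatype fm =
    EqF expr expr
  | NotF fm
  | AndF fm fm
  | ExF nat expr fm
  | NthF nat expr expr fm

text \<open>\<open>NthF\<close> is a binding, not a quantifier, and any list can serve as the index
  through its length. Past the end of the list the entry is \<open>Leaf\<close>.\<close>

primrec holds :: "fm \<Rightarrow> state \<Rightarrow> bool" where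
  "holds (EqF a b) s \<longleftrightarrow> eval_expr a s = eval_expr b s"
| "holds (NotF \<phi>) s \<longleftrightarrow> \<not> holds \<phi> s"
| "holds (AndF \<phi> \<psi>) s \<longleftrightarrow> holds \<phi> s \<and> holds \<psi> s"
| "holds (ExF v e \<phi>) s \<longleftrightarrow> (\<exists>k<len (eval_expr e s). holds \<phi> (s(v := unary k)))"
| "holds (NthF v i e \<phi>) s \<longleftrightarrow>
     holds \<phi> (s(v := left ((right ^^ len (eval_expr i s)) (eval_expr e s))))"

primrec expr_bound :: "expr \<Rightarrow> nat" where
  "expr_bound NilE = 0"
| "expr_bound (V i) = Suc i"
| "expr_bound (ConsE a b) = max (expr_bound a) (expr_bound b)"
| "expr_bound (HdE a) = expr_bound a"
| "expr_bound (TlE a) = expr_bound a"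

primrec fm_bound :: "fm \<Rightarrow> nat" where
  "fm_bound (EqF a b) = max (expr_bound a) (expr_bound b)"
| "fm_bound (NotF \<phi>) = fm_bound \<phi>"
| "fm_bound (AndF \<phi> \<psi>) = max (fm_bound \<phi>) (fm_bound \<psi>)"
| "fm_bound (ExF v e \<phi>) = max (Suc v) (max (expr_bound e) (fm_bound \<phi>))"
| "fm_bound (NthF v i e \<phi>) =
     max (Suc v) (max (max (expr_bound i) (expr_bound e)) (fm_bound \<phi>))"

lemma eval_expr_cong:
  assumes "\<And>i. i < expr_bound e \<Longrightarrow> s i = s' i"
  shows "eval_expr e s = eval_expr e s'"
  using assms by (induction e) auto

lemma holds_cong:
  assumes "\<And>i. i < fm_bound \<phi> \<Longrightarrow> s i = s' i"
  shows "holds \<phi> s = holds \<phi> s'"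
  using assms
proof (induction \<phi> arbitrary: s s')
  case (EqF a b)
  have "eval_expr a s = eval_expr a s'" "eval_expr b s = eval_expr b s'"
    using EqF.prems by (auto intro!: eval_expr_cong)
  then show ?case by simp
next
  case (NotF \<phi>)
  have "holds \<phi> s = holds \<phi> s'"
    using NotF.prems by (auto intro!: NotF.IH)
  then show ?case by simp
next
  case (AndF \<phi> \<psi>)
  have "holds \<phi> s = holds \<phi> s'" "holds \<psi> s = holds \<psi> s'"
    using AndF.prems by (auto intro!: AndF.IH)
  then show ?case by simp
next
  case (ExF v e \<phi>)
  have "eval_expr e s = eval_expr e s'"
    using ExF.prems by (auto intro!: eval_expr_cong)
  moreover have "holds \<phi> (s(v := t)) = holds \<phi> (s'(v := t))" for t
    using ExF.prems by (intro ExF.IH) auto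
  ultimately show ?case by simp
next
  case (NthF v i e \<phi>)
  have "eval_expr e s = eval_expr e s'" "eval_expr i s = eval_expr i s'"
    using NthF.prems by (auto intro!: eval_expr_cong)
  moreover have "holds \<phi> (s(v := t)) = holds \<phi> (s'(v := t))" for t
    using NthF.prems by (intro NthF.IH) auto
  ultimately show ?case by simp
qed

text \<open>Each occurrence of a register contributes at most \<open>n\<close> nodes and each
  \<open>ConsE\<close> one more; \<open>cost\<close> counts both.\<close>

lemma size_eval_expr:
  assumes "\<And>i. i < expr_bound e \<Longrightarrow> size (s i) \<le> n"
  shows "size (eval_expr e s) \<le> cost e * (n + 1)"
  using assms
proof (induction e)
  case (V i)
  then show ?case by (simp add: le_SucI)
next
  case (ConsE a b)
  then have "size (eval_expr a s) \<le> cost a * (n + 1)" "size (eval_expr b s) \<le> cost b * (n + 1)"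
    by auto
  then show ?case by (simp add: algebra_simps)
next
  case (HdE a)
  then have "size (eval_expr a s) \<le> cost a * (n + 1)" by auto
  then show ?case using size_left [of "eval_expr a s"] by (simp add: algebra_simps)
next
  case (TlE a)
  then have "size (eval_expr a s) \<le> cost a * (n + 1)" by auto
  then show ?case using size_right [of "eval_expr a s"] by (simp add: algebra_simps)
qed simp

text \<open>The answer is returned in register \<open>r\<close>; the registers from \<open>r\<close> on are scratch space.\<close>

definition decides :: "com \<Rightarrow> (nat \<Rightarrow> nat) \<Rightarrow> nat \<Rightarrow> fm \<Rightarrow> bool" where
  "decides c T r \<phi> \<longleftrightarrow> (\<forall>s n. (\<forall>i<r. size (s i) \<le> n) \<longrightarrow>
     runs c s (T n) (\<lambda>s'. (s' r \<noteq> Leaf \<longleftrightarrow> holds \<phi> s) \<and> (\<forall>i<r. s' i = s i)))"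

section \<open>Programs for connectives and equality\<close>

lemma decides_NotF:
  assumes "decides c T r \<phi>"
  shows "decides (Seq c (Cond (V r) (Assign r NilE) (Assign r (ConsE NilE NilE))))
    (\<lambda>n. T n + 9) r (NotF \<phi>)"
  unfolding decides_def
proof (intro allI impI)
  fix s :: state and n assume "\<forall>i<r. size (s i) \<le> n"
  then have c: "runs c s (T n) (\<lambda>s'. (s' r \<noteq> Leaf \<longleftrightarrow> holds \<phi> s) \<and> (\<forall>i<r. s' i = s i))"
    using assms unfolding decides_def by blast
  show "runs (Seq c (Cond (V r) (Assign r NilE) (Assign r (ConsE NilE NilE)))) s (T n + 9)
      (\<lambda>s'. (s' r \<noteq> Leaf \<longleftrightarrow> holds (NotF \<phi>) s) \<and> (\<forall>i<r. s' i = s i))"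
    by (rule runs_SeqI [where U = 8, OF runs_mono [OF c order.refl]]) (auto simp: runs_simps)
qed

text \<open>A false answer of \<open>c\<close> is already the answer in register \<open>r\<close>.
  Otherwise \<open>d\<close> may overwrite \<open>r\<close>, because \<open>\<psi>\<close> reads
  only registers below it.\<close>

lemma decides_AndF:
  assumes "decides c T r \<phi>" "decides d U r \<psi>" "fm_bound \<psi> \<le> r"
  shows "decides (Seq c (Cond (V r) d Skip)) (\<lambda>n. T n + U n + 4) r (AndF \<phi> \<psi>)"
  unfolding decides_def
proof (intro allI impI)
  fix s :: state and n assume n: "\<forall>i<r. size (s i) \<le> n"
  then have "runs c s (T n) (\<lambda>s'. (s' r \<noteq> Leaf \<longleftrightarrow> holds \<phi> s) \<and> (\<forall>i<r. s' i = s i))"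
    using assms(1) unfolding decides_def by blast
  then have "runs c s (T n) (\<lambda>s'. runs (Cond (V r) d Skip) s' (U n + 3)
      (\<lambda>s'. (s' r \<noteq> Leaf \<longleftrightarrow> holds (AndF \<phi> \<psi>) s) \<and> (\<forall>i<r. s' i = s i)))"
  proof (rule runs_mono)
    fix s' assume s': "(s' r \<noteq> Leaf \<longleftrightarrow> holds \<phi> s) \<and> (\<forall>i<r. s' i = s i)"
    then have "\<forall>i<r. size (s' i) \<le> n" using n by simp
    then have d: "runs d s' (U n) (\<lambda>s''. (s'' r \<noteq> Leaf \<longleftrightarrow> holds \<psi> s') \<and> (\<forall>i<r. s'' i = s' i))"
      using assms(2) unfolding decides_def by blast
    have eq: "holds \<psi> s' = holds \<psi> s"
      using s' assms(3) by (intro holds_cong) auto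
    show "runs (Cond (V r) d Skip) s' (U n + 3)
      (\<lambda>s'. (s' r \<noteq> Leaf \<longleftrightarrow> holds (AndF \<phi> \<psi>) s) \<and> (\<forall>i<r. s' i = s i))"
    proof (cases "s' r = Leaf")
      case True
      with s' show ?thesis by (simp add: runs_Cond_iff runs_Skip_iff)
    next
      case False
      have "runs d s' (U n + 1) (\<lambda>s'. (s' r \<noteq> Leaf \<longleftrightarrow> holds (AndF \<phi> \<psi>) s) \<and> (\<forall>i<r. s' i = s i))"
        by (rule runs_mono [OF d]) (use False s' eq in auto)
      with False show ?thesis by (simp add: runs_Cond_iff)
    qed
  qed simp
  then show "runs (Seq c (Cond (V r) d Skip)) s (T n + U n + 4)
      (\<lambda>s'. (s' r \<noteq> Leaf \<longleftrightarrow> holds (AndF \<phi> \<psi>) s) \<and> (\<forall>i<r. s' i = s i))"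
    by (rule runs_SeqI) simp
qed

text \<open>Programs test only for \<open>Leaf\<close> and have no recursion, so trees are compared
  through a worklist of pairs in \<open>r + 1\<close>. A mismatch clears the flag in
  \<open>r\<close>, and the loop goes on to empty the list.\<close>

definition eq_body :: "nat \<Rightarrow> com" where
  "eq_body r =
     Seq (Assign (r + 2) (HdE (HdE (V (r + 1)))))
    (Seq (Assign (r + 3) (TlE (HdE (V (r + 1)))))
    (Seq (Assign (r + 1) (TlE (V (r + 1))))
      (Cond (V (r + 2))
        (Cond (V (r + 3))
          (Assign (r + 1) (ConsE (ConsE (HdE (V (r + 2))) (HdE (V (r + 3))))
            (ConsE (ConsE (TlE (V (r + 2))) (TlE (V (r + 3)))) (V (r + 1)))))
          (Assign r NilE))
        (Cond (V (r + 3)) (Assign r NilE) Skip))))"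

definition eq_prog :: "nat \<Rightarrow> expr \<Rightarrow> expr \<Rightarrow> com" where
  "eq_prog r a b =
     Seq (Assign (r + 1) (ConsE (ConsE a b) NilE))
    (Seq (Assign r (ConsE NilE NilE)) (While (V (r + 1)) (eq_body r)))"

primrec worklist :: "(tree \<times> tree) list \<Rightarrow> tree" where
  "worklist [] = Leaf"
| "worklist (p # ps) = Node (Node (fst p) (snd p)) (worklist ps)"

text \<open>Comparing two inner nodes replaces one pair of total weight \<open>2 * (l + r + 1) + 1\<close> by two pairs of
  total weight one less.\<close>

primrec weight :: "tree \<Rightarrow> nat" where
  "weight Leaf = 0"
| "weight (Node p t) = 2 * size (left p) + 1 + weight t"

lemma runs_eq_body:
  assumes "s (r + 1) = Node (Node x y) w"
  shows "runs (eq_body r) s 60 (\<lambda>s'. (\<forall>i<r. s' i = s i) \<and>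
    (if x \<noteq> Leaf \<and> y \<noteq> Leaf then s' r = s r \<and>
       s' (r + 1) = Node (Node (left x) (left y)) (Node (Node (right x) (right y)) w)
     else s' (r + 1) = w \<and> (s' r \<noteq> Leaf \<longleftrightarrow> s r \<noteq> Leaf \<and> x = y)))"
  using assms by (cases x; cases y) (simp_all add: eq_body_def runs_simps)

lemma decides_EqF:
  assumes "expr_bound a \<le> r" "expr_bound b \<le> r"
  shows "decides (eq_prog r a b)
    (\<lambda>n. (2 * (cost a * (n + 1)) + 2) * 62 + (cost a + cost b + 10)) r (EqF a b)"
  unfolding decides_def
proof (intro allI impI)
  fix s :: state and n
  assume n: "\<forall>i<r. size (s i) \<le> n"
  let ?Q = "\<lambda>s'. (s' r \<noteq> Leaf \<longleftrightarrow> holds (EqF a b) s) \<and> (\<forall>i<r. s' i = s i)"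
  define G where "G = holds (EqF a b) s"
  \<comment> \<open>The flag and the pending pairs together remain equivalent to \<open>G\<close>: a
    pair is either split into two pairs of subtrees or dropped with its outcome recorded in the
    flag.\<close>
  define I where "I s' \<longleftrightarrow> (\<exists>ps. s' (r + 1) = worklist ps \<and>
    (s' r \<noteq> Leaf \<and> (\<forall>(x, y)\<in>set ps. x = y) \<longleftrightarrow> G) \<and> (\<forall>i<r. s' i = s i))"
    for s' :: state
  let ?m = "\<lambda>s' :: state. weight (s' (r + 1))"
  have step: "runs (eq_body r) s' 60 (\<lambda>s''. I s'' \<and> ?m s'' < ?m s')"
    if I: "I s'" and ne: "eval_expr (V (r + 1)) s' \<noteq> Leaf" for s'
  proof -
    obtain qs where q: "s' (r + 1) = worklist qs"
      "s' r \<noteq> Leaf \<and> (\<forall>(x, y)\<in>set qs. x = y) \<longleftrightarrow> G" "\<forall>i<r. s' i = s i"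
      using I unfolding I_def by blast
    obtain x y ps where qs: "qs = (x, y) # ps"
      using ne q(1) by (cases qs) auto
    show ?thesis
    proof (rule runs_mono [OF runs_eq_body order.refl])
      show "s' (r + 1) = Node (Node x y) (worklist ps)"
        using q(1) qs by simp
    next
      fix s''
      assume s'': "(\<forall>i<r. s'' i = s' i) \<and>
        (if x \<noteq> Leaf \<and> y \<noteq> Leaf then s'' r = s' r \<and>
           s'' (r + 1) = Node (Node (left x) (left y)) (Node (Node (right x) (right y)) (worklist ps))
         else s'' (r + 1) = worklist ps \<and> (s'' r \<noteq> Leaf \<longleftrightarrow> s' r \<noteq> Leaf \<and> x = y))"
      show "I s'' \<and> ?m s'' < ?m s'"
      proof (cases "x \<noteq> Leaf \<and> y \<noteq> Leaf")
        case True
        then obtain xl xr yl yr where xy: "x = Node xl xr" "y = Node yl yr"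
          by (meson tree.exhaust)
        from s'' True have *: "\<forall>i<r. s'' i = s' i" "s'' r = s' r"
          "s'' (r + 1) = worklist ((xl, yl) # (xr, yr) # ps)"
          by (simp_all add: xy)
        have "I s''" unfolding I_def
          by (intro exI [of _ "(xl, yl) # (xr, yr) # ps"] conjI)
            (use * q xy qs in auto)
        moreover have "?m s'' < ?m s'" unfolding * q(1) qs xy by simp
        ultimately show ?thesis ..
      next
        case False
        with s'' have *: "\<forall>i<r. s'' i = s' i" "s'' (r + 1) = worklist ps"
          "s'' r \<noteq> Leaf \<longleftrightarrow> s' r \<noteq> Leaf \<and> x = y"
          by (simp_all split: if_splits)
        have "I s''" unfolding I_def
          by (intro exI [of _ ps] conjI) (use * q qs in auto)
        moreover have "?m s'' < ?m s'" unfolding * q(1) qs by simp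
        ultimately show ?thesis ..
      qed
    qed
  qed
  define s1 where "s1 = s(r + 1 := Node (Node (eval_expr a s) (eval_expr b s)) Leaf, r := Node Leaf Leaf)"
  have "I s1"
    unfolding I_def by (intro exI [of _ "[(eval_expr a s, eval_expr b s)]"]) (auto simp: s1_def G_def)
  have w: "runs (While (V (r + 1)) (eq_body r)) s1
      ((2 * (cost a * (n + 1)) + 1 + 1) * (cost (V (r + 1)) + 60 + 1)) ?Q"
  proof (rule runs_While [of I "V (r + 1)" "eq_body r" 60 ?m])
    show "I s1" by fact
    \<comment> \<open>The weight looks only at the first tree of each pair, so the number of
      iterations is bounded through \<open>a\<close> alone.\<close>
    show "?m s1 \<le> 2 * (cost a * (n + 1)) + 1"
      using size_eval_expr [of a s n] assms n by (simp add: s1_def)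
  next
    fix s' assume "I s'" "eval_expr (V (r + 1)) s' = Leaf"
    then obtain ps where ps: "s' (r + 1) = worklist ps" "s' (r + 1) = Leaf"
      "s' r \<noteq> Leaf \<and> (\<forall>(x, y)\<in>set ps. x = y) \<longleftrightarrow> G" "\<forall>i<r. s' i = s i"
      unfolding I_def eval_expr.simps by blast
    then show "?Q s'" by (cases ps) (simp_all add: G_def)
  qed (rule step)
  have "runs (eq_prog r a b) s
      (cost (ConsE (ConsE a b) NilE) + 2 + (cost (ConsE NilE NilE) + 2 +
        (2 * (cost a * (n + 1)) + 1 + 1) * (cost (V (r + 1)) + 60 + 1))) ?Q"
    unfolding eq_prog_def
    by (rule runs_Seq_AssignI [OF runs_Seq_AssignI [OF w]]) (simp_all add: s1_def)
  then show "runs (eq_prog r a b) s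
      ((2 * (cost a * (n + 1)) + 2) * 62 + (cost a + cost b + 10)) ?Q"
    by (rule runs_mono) simp_all
qed

section \<open>Programs for list access and bounded quantification\<close>

lemma eval_expr_fun_upd [simp]: "expr_bound e \<le> j \<Longrightarrow> eval_expr e (s(j := t)) = eval_expr e s"
  by (rule eval_expr_cong) simp

definition drop_loop :: "nat \<Rightarrow> nat \<Rightarrow> com" where
  "drop_loop j v = While (V j) (Seq (Assign v (TlE (V v))) (Assign j (TlE (V j))))"

lemma runs_drop_loop:
  assumes "v \<noteq> j" "len (s j) \<le> M"
  shows "runs (drop_loop j v) s ((M + 1) * 9) (\<lambda>s'. s' = s(j := Leaf, v := (right ^^ len (s j)) (s v)))"
proof -
  \<comment> \<open>Finishing the remaining work from \<open>s'\<close> gives the intended final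
    state; once \<open>j\<close> holds \<open>Leaf\<close>, nothing remains.\<close>
  define I where "I s' \<longleftrightarrow> s'(j := Leaf, v := (right ^^ len (s' j)) (s' v)) =
    s(j := Leaf, v := (right ^^ len (s j)) (s v))" for s' :: state
  have "runs (While (V j) (Seq (Assign v (TlE (V v))) (Assign j (TlE (V j))))) s
    ((M + 1) * (cost (V j) + 7 + 1)) (\<lambda>s'. s' = s(j := Leaf, v := (right ^^ len (s j)) (s v)))"
  proof (rule runs_While [of I _ _ _ "\<lambda>s'. len (s' j)"])
    fix s' assume I: "I s'" and "eval_expr (V j) s' \<noteq> Leaf"
    then obtain a b where ab: "s' j = Node a b" by (cases "s' j") auto
    let ?s = "s'(v := right (s' v), j := b)"
    have "?s(j := Leaf, v := (right ^^ len (?s j)) (?s v)) =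
        s'(j := Leaf, v := (right ^^ len (s' j)) (s' v))"
      using assms(1) by (auto simp: ab fun_eq_iff funpow_swap1)
    with I have "I ?s" unfolding I_def by simp
    then show "runs (Seq (Assign v (TlE (V v))) (Assign j (TlE (V j)))) s' 7
        (\<lambda>s''. I s'' \<and> len (s'' j) < len (s' j))"
      using assms(1) by (simp add: runs_simps ab)
  next
    fix s' assume I: "I s'" and "eval_expr (V j) s' = Leaf"
    then have "s'(j := Leaf, v := (right ^^ len (s' j)) (s' v)) = s'"
      by auto
    with I show "s' = s(j := Leaf, v := (right ^^ len (s j)) (s v))"
      unfolding I_def by simp
  qed (simp_all add: I_def assms)
  then show ?thesis by (simp add: drop_loop_def)
qed

text \<open>\<open>i\<close> and \<open>e\<close> may mention \<open>v\<close>, so both are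
  evaluated before \<open>v\<close> changes, and its old value is kept in \<open>r + 2\<close>.
  Registers \<open>r\<close> to \<open>r + 2\<close> count as input of \<open>c\<close>, whose
  scratch space starts at \<open>r + 3\<close>; clearing \<open>r\<close> keeps their sizes
  bounded.\<close>

definition nth_prog :: "nat \<Rightarrow> nat \<Rightarrow> expr \<Rightarrow> expr \<Rightarrow> com \<Rightarrow> com" where
  "nth_prog r v i e c =
     Seq (Assign (r + 1) i)
    (Seq (Assign (r + 2) (V v))
    (Seq (Assign v e)
    (Seq (Assign r NilE)
    (Seq (drop_loop (r + 1) v)
    (Seq (Assign v (HdE (V v)))
    (Seq c
    (Seq (Assign r (V (r + 3)))
      (Assign v (V (r + 2))))))))))"

lemma decides_NthF:
  assumes c: "decides c T (r + 3) \<phi>" and bound: "fm_bound (NthF v i e \<phi>) \<le> r"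
  shows "decides (nth_prog r v i e c)
    (\<lambda>n. T (n + cost e * (n + 1)) + (cost i * (n + 1) + 1) * 9 + (cost i + cost e + 30))
    r (NthF v i e \<phi>)"
  unfolding decides_def
proof (intro allI impI)
  fix s :: state and n
  assume n: "\<forall>i<r. size (s i) \<le> n"
  let ?Q = "\<lambda>s'. (s' r \<noteq> Leaf \<longleftrightarrow> holds (NthF v i e \<phi>) s) \<and> (\<forall>i<r. s' i = s i)"
  define E where "E = eval_expr e s"
  define N where "N = eval_expr i s"
  have b: "v < r" "expr_bound i \<le> r" "expr_bound e \<le> r" "fm_bound \<phi> \<le> r"
    using bound by auto
  have E: "size E \<le> cost e * (n + 1)"
    unfolding E_def using n b by (intro size_eval_expr) auto
  have N: "len N \<le> cost i * (n + 1)"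
    unfolding N_def using n b by (intro order_trans [OF len_le_size] size_eval_expr) auto
  define s1 where "s1 = s(r + 1 := N, r + 2 := s v, v := E, r := Leaf)"
  define x where "x = left ((right ^^ len N) E)"
  define s2 where "s2 = s(r + 1 := Leaf, r + 2 := s v, v := x, r := Leaf)"
  have x: "size x \<le> cost e * (n + 1)"
    unfolding x_def by (rule order_trans [OF size_left order_trans [OF size_right_funpow E]])
  have loop: "runs (drop_loop (r + 1) v) s1 ((cost i * (n + 1) + 1) * 9)
      (\<lambda>s'. s' = s1(r + 1 := Leaf, v := (right ^^ len N) E))"
    using runs_drop_loop [of v "r + 1" s1 "cost i * (n + 1)"] b N by (simp add: s1_def)
  have "\<forall>i<r + 3. size (s2 i) \<le> n + cost e * (n + 1)"
  proof (intro allI impI)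
    fix j assume "j < r + 3"
    then consider "j = v" | "j < r" "j \<noteq> v" | "j = r" | "j = r + 1" | "j = r + 2" by linarith
    then show "size (s2 j) \<le> n + cost e * (n + 1)"
      using n b x by cases (auto simp: s2_def trans_le_add1)
  qed
  then have run: "runs c s2 (T (n + cost e * (n + 1)))
      (\<lambda>s'. (s' (r + 3) \<noteq> Leaf \<longleftrightarrow> holds \<phi> s2) \<and> (\<forall>i<r + 3. s' i = s2 i))"
    using c unfolding decides_def by blast
  have eq: "holds \<phi> s2 \<longleftrightarrow> holds (NthF v i e \<phi>) s"
    unfolding holds.simps using b
    by (intro holds_cong) (auto simp: s2_def x_def E_def N_def)
  have tail: "runs (Seq c (Seq (Assign r (V (r + 3))) (Assign v (V (r + 2))))) s2
      (T (n + cost e * (n + 1)) + 10) ?Q"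
  proof (rule runs_SeqI [where U = 8, OF runs_mono [OF run order.refl]])
    fix s' assume s': "(s' (r + 3) \<noteq> Leaf \<longleftrightarrow> holds \<phi> s2) \<and> (\<forall>i<r + 3. s' i = s2 i)"
    then have "s' (r + 2) = s v" "s' (r + 3) \<noteq> Leaf \<longleftrightarrow> holds (NthF v i e \<phi>) s"
      "\<forall>i<r. i \<noteq> v \<longrightarrow> s' i = s i"
      using b eq by (auto simp: s2_def)
    then show "runs (Seq (Assign r (V (r + 3))) (Assign v (V (r + 2)))) s' 8 ?Q"
      using b by (simp add: runs_simps del: holds.simps)
  qed simp
  have s2: "s1(r + 1 := Leaf, v := x) = s2"
    using b by (auto simp: s1_def s2_def)
  have "runs (Seq (drop_loop (r + 1) v) (Seq (Assign v (HdE (V v)))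
      (Seq c (Seq (Assign r (V (r + 3))) (Assign v (V (r + 2))))))) s1
      ((cost i * (n + 1) + 1) * 9 + (T (n + cost e * (n + 1)) + 14) + 1) ?Q"
  proof (rule runs_SeqI [where U = "T (n + cost e * (n + 1)) + 14", OF runs_mono [OF loop order.refl]])
    fix s' assume "s' = s1(r + 1 := Leaf, v := (right ^^ len N) E)"
    then have "s'(v := left (s' v)) = s2"
      using s2 by (simp add: x_def)
    then show "runs (Seq (Assign v (HdE (V v)))
      (Seq c (Seq (Assign r (V (r + 3))) (Assign v (V (r + 2)))))) s' (T (n + cost e * (n + 1)) + 14) ?Q"
      using tail by (simp only: runs_Seq_Assign_iff eval_expr.simps cost.simps)
        (auto elim: runs_mono simp del: holds.simps)
  qed simp
  note rest = this
  have "runs (nth_prog r v i e c) s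
      (cost i + 2 + (cost (V v) + 2 + (cost e + 2 + (cost NilE + 2 +
        ((cost i * (n + 1) + 1) * 9 + (T (n + cost e * (n + 1)) + 14) + 1))))) ?Q"
    unfolding nth_prog_def
    by (rule runs_Seq_AssignI [OF runs_Seq_AssignI [OF runs_Seq_AssignI [OF runs_Seq_AssignI [OF rest]]]])
      (use b in \<open>simp_all add: s1_def N_def E_def\<close>)
  then show "runs (nth_prog r v i e c) s
      (T (n + cost e * (n + 1)) + (cost i * (n + 1) + 1) * 9 + (cost i + cost e + 30)) ?Q"
    by (rule runs_mono) simp_all
qed

text \<open>\<open>r + 1\<close> counts down along the list, \<open>r + 3\<close> counts up in
  unary, \<open>r\<close> accumulates the disjunction, and \<open>r + 4\<close> receives the answer
  of \<open>c\<close>. The search runs on after a witness, which a worst-case bound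
  tolerates.\<close>

definition ex_body :: "nat \<Rightarrow> nat \<Rightarrow> com \<Rightarrow> com" where
  "ex_body r v c =
     Seq (Assign v (V (r + 3)))
    (Seq c
    (Seq (Assign (r + 3) (ConsE NilE (V (r + 3))))
    (Seq (Assign (r + 1) (TlE (V (r + 1))))
      (Cond (V (r + 4)) (Assign r (ConsE NilE NilE)) Skip))))"

definition ex_prog :: "nat \<Rightarrow> nat \<Rightarrow> expr \<Rightarrow> com \<Rightarrow> com" where
  "ex_prog r v e c =
     Seq (Assign r NilE)
    (Seq (Assign (r + 1) e)
    (Seq (Assign (r + 2) (V v))
    (Seq (Assign (r + 3) NilE)
    (Seq (While (V (r + 1)) (ex_body r v c))
      (Assign v (V (r + 2)))))))"

lemma decides_ExF:
  assumes c: "decides c T (r + 4) \<phi>" and bound: "fm_bound (ExF v e \<phi>) \<le> r"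
  shows "decides (ex_prog r v e c)
    (\<lambda>n. (cost e * (n + 1) + 1) * (T (n + cost e * (n + 1) + 1) + 26) + (cost e + 20))
    r (ExF v e \<phi>)"
  unfolding decides_def
proof (intro allI impI)
  fix s :: state and n
  assume n: "\<forall>i<r. size (s i) \<le> n"
  let ?Q = "\<lambda>s'. (s' r \<noteq> Leaf \<longleftrightarrow> holds (ExF v e \<phi>) s) \<and> (\<forall>i<r. s' i = s i)"
  define E where "E = eval_expr e s"
  define S where "S = cost e * (n + 1)"
  define P where "P k \<longleftrightarrow> holds \<phi> (s(v := unary k))" for k
  have b: "v < r" "expr_bound e \<le> r" "fm_bound \<phi> \<le> r"
    using bound by auto
  have E: "size E \<le> S"
    unfolding E_def S_def using n b by (intro size_eval_expr) auto
  \<comment> \<open>The size conditions belong to the invariant because registers up to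
    \<open>r + 3\<close> are input of \<open>c\<close>, whose time bound depends on their size. The
    content of \<open>v\<close> is left open, as each pass overwrites it.\<close>
  define I where "I s' \<longleftrightarrow> (\<exists>k. s' (r + 3) = unary k \<and> len (s' (r + 1)) + k = len E \<and>
      size (s' (r + 1)) \<le> S \<and> s' (r + 2) = s v \<and> (\<forall>i<r. i \<noteq> v \<longrightarrow> s' i = s i) \<and>
      size (s' r) \<le> 1 \<and> (s' r \<noteq> Leaf \<longleftrightarrow> (\<exists>j<k. P j)))" for s' :: state
  have step: "runs (ex_body r v c) s' (T (n + S + 1) + 24) (\<lambda>s''. I s'' \<and> len (s'' (r + 1)) < len (s' (r + 1)))"
    if I: "I s'" and ne: "eval_expr (V (r + 1)) s' \<noteq> Leaf" for s'
  proof -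
    obtain k where k: "s' (r + 3) = unary k" "len (s' (r + 1)) + k = len E"
      "size (s' (r + 1)) \<le> S" "s' (r + 2) = s v" "\<forall>i<r. i \<noteq> v \<longrightarrow> s' i = s i"
      "size (s' r) \<le> 1" "s' r \<noteq> Leaf \<longleftrightarrow> (\<exists>j<k. P j)"
      using I unfolding I_def by blast
    obtain a l where al: "s' (r + 1) = Node a l"
      using ne by (cases "s' (r + 1)") auto
    then have al': "s' (Suc r) = Node a l" by simp
    have "k \<le> S"
      using k(2) len_le_size [of E] E by linarith
    define s2 where "s2 = s'(v := unary k)"
    have "\<forall>i<r + 4. size (s2 i) \<le> n + S + 1"
    proof (intro allI impI)
      fix j assume "j < r + 4"
      then consider "j = v" | "j < r" "j \<noteq> v" | "j = r" | "j = r + 1" | "j = r + 2" | "j = r + 3"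
        by linarith
      then show "size (s2 j) \<le> n + S + 1"
      proof cases
        case 2
        then have "size (s2 j) \<le> n" using k(5) n by (simp add: s2_def)
        then show ?thesis by simp
      next
        case 5
        then have "size (s2 j) \<le> n" using k(4) n b by (simp add: s2_def)
        then show ?thesis by simp
      qed (use k b \<open>k \<le> S\<close> in \<open>auto simp: s2_def\<close>)
    qed
    then have run: "runs c s2 (T (n + S + 1))
        (\<lambda>s'. (s' (r + 4) \<noteq> Leaf \<longleftrightarrow> holds \<phi> s2) \<and> (\<forall>i<r + 4. s' i = s2 i))"
      using c unfolding decides_def by blast
    have eq: "holds \<phi> s2 \<longleftrightarrow> P k"
      unfolding P_def using b k(5) by (intro holds_cong) (auto simp: s2_def)
    let ?tail = "Seq (Assign (r + 3) (ConsE NilE (V (r + 3))))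
      (Seq (Assign (r + 1) (TlE (V (r + 1)))) (Cond (V (r + 4)) (Assign r (ConsE NilE NilE)) Skip))"
    have "runs (Seq c ?tail) s2 (T (n + S + 1) + 21) (\<lambda>s''. I s'' \<and> len (s'' (r + 1)) < len (s' (r + 1)))"
    proof (rule runs_SeqI [where U = 20, OF runs_mono [OF run order.refl]])
      fix s3 assume s3: "(s3 (r + 4) \<noteq> Leaf \<longleftrightarrow> holds \<phi> s2) \<and> (\<forall>i<r + 4. s3 i = s2 i)"
      have f: "s3 (r + 3) = unary k" "s3 (r + 1) = Node a l" "s3 (r + 2) = s v" "s3 r = s' r"
        "\<forall>i<r. i \<noteq> v \<longrightarrow> s3 i = s i" "s3 (r + 4) \<noteq> Leaf \<longleftrightarrow> P k" "s3 (Suc r) = Node a l"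
        using s3 k b al eq by (auto simp: s2_def)
      define s4 where "s4 = s3(r + 3 := unary (Suc k), r + 1 := l)"
      have ext: "(\<exists>j<Suc k. P j) \<longleftrightarrow> (\<exists>j<k. P j) \<or> P k"
        by (auto simp: less_Suc_eq)
      have "I (if P k then s4(r := Node Leaf Leaf) else s4)"
        unfolding I_def using k f al ext
        by (intro exI [of _ "Suc k"]) (auto simp: s4_def)
      moreover have "len ((if P k then s4(r := Node Leaf Leaf) else s4) (r + 1)) < len (s' (r + 1))"
        by (simp add: s4_def al')
      moreover have "s3(r + 3 := Node Leaf (s3 (r + 3)), r + 1 := right (s3 (r + 1))) = s4"
        by (simp add: f s4_def)
      ultimately show "runs ?tail s3 20 (\<lambda>s''. I s'' \<and> len (s'' (r + 1)) < len (s' (r + 1)))"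
        using f(6) by (cases "P k") (simp_all add: runs_simps s4_def f(1-5,7) al')
    qed simp
    then have "runs (ex_body r v c) s' (cost (V (r + 3)) + 2 + (T (n + S + 1) + 21))
        (\<lambda>s''. I s'' \<and> len (s'' (r + 1)) < len (s' (r + 1)))"
      unfolding ex_body_def by (rule runs_Seq_AssignI) (simp add: s2_def k)
    then show ?thesis by (rule runs_mono) simp_all
  qed
  define s1 where "s1 = s(r := Leaf, r + 1 := E, r + 2 := s v, r + 3 := Leaf)"
  have "runs (While (V (r + 1)) (ex_body r v c)) s1
      ((S + 1) * (cost (V (r + 1)) + (T (n + S + 1) + 24) + 1))
      (\<lambda>s'. runs (Assign v (V (r + 2))) s' 2 ?Q)"
  proof (rule runs_While [of I _ _ _ "\<lambda>s'. len (s' (r + 1))"])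
    show "I s1"
      unfolding I_def using E b by (intro exI [of _ 0]) (simp add: s1_def)
    show "len (s1 (r + 1)) \<le> S"
      using E len_le_size [of E] by (simp add: s1_def)
  next
    fix s' assume "I s'" "eval_expr (V (r + 1)) s' = Leaf"
    then obtain k where k: "len (s' (r + 1)) + k = len E" "s' (r + 1) = Leaf" "s' (r + 2) = s v"
      "\<forall>i<r. i \<noteq> v \<longrightarrow> s' i = s i" "s' r \<noteq> Leaf \<longleftrightarrow> (\<exists>j<k. P j)"
      unfolding I_def eval_expr.simps by blast
    then have "s' r \<noteq> Leaf \<longleftrightarrow> holds (ExF v e \<phi>) s"
      by (simp add: P_def E_def)
    then show "runs (Assign v (V (r + 2))) s' 2 ?Q"
      using k b by (simp add: runs_simps del: holds.simps)
  qed (rule step)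
  note loop = runs_SeqI [OF this order.refl]
  have "runs (ex_prog r v e c) s
      (cost NilE + 2 + (cost e + 2 + (cost (V v) + 2 + (cost NilE + 2 +
        ((S + 1) * (cost (V (r + 1)) + (T (n + S + 1) + 24) + 1) + 2 + 1))))) ?Q"
    unfolding ex_prog_def
    by (rule runs_Seq_AssignI [OF runs_Seq_AssignI [OF runs_Seq_AssignI [OF runs_Seq_AssignI [OF loop]]]])
      (use b in \<open>simp_all add: s1_def E_def\<close>)
  then show "runs (ex_prog r v e c) s
      ((cost e * (n + 1) + 1) * (T (n + cost e * (n + 1) + 1) + 26) + (cost e + 20)) ?Q"
    unfolding S_def [symmetric] by (rule runs_mono) (simp_all add: algebra_simps)
qed

text \<open>\<open>r\<close> is generalized because a subformula needs its scratch space above the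
  registers of the enclosing loop. A quantifier multiplies the time of its body by a linear factor
  and evaluates that time at a linearly larger size, so both products and compositions
  occur.\<close>

theorem fm_decidable:
  assumes "fm_bound \<phi> \<le> r"
  shows "\<exists>c T. poly_bounded T \<and> decides c T r \<phi>"
  using assms
proof (induction \<phi> arbitrary: r)
  case (EqF a b)
  then have "decides (eq_prog r a b)
    (\<lambda>n. (2 * (cost a * (n + 1)) + 2) * 62 + (cost a + cost b + 10)) r (EqF a b)"
    by (intro decides_EqF) auto
  moreover have "poly_bounded
      (\<lambda>n. (2 * (cost a * (n + 1)) + 2) * 62 + (cost a + cost b + 10))"
    by (intro poly_bounded_intros)
  ultimately show ?case by blast
next
  case (NotF \<phi>)
  have "\<exists>c T. poly_bounded T \<and> decides c T r \<phi>"
    using NotF.prems by (intro NotF.IH) simp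
  then obtain c T where T: "poly_bounded T" and c: "decides c T r \<phi>" by blast
  have "poly_bounded (\<lambda>n. T n + 9)"
    using T by (intro poly_bounded_intros)
  with decides_NotF [OF c] show ?case by blast
next
  case (AndF \<phi> \<psi>)
  have bound: "fm_bound \<phi> \<le> r" "fm_bound \<psi> \<le> r" using AndF.prems by simp_all
  obtain c T where T: "poly_bounded T" and c: "decides c T r \<phi>"
    using AndF.IH(1) [OF bound(1)] by blast
  obtain d U where U: "poly_bounded U" and d: "decides d U r \<psi>"
    using AndF.IH(2) [OF bound(2)] by blast
  have "poly_bounded (\<lambda>n. T n + U n + 4)"
    using T U by (intro poly_bounded_intros)
  with decides_AndF [OF c d bound(2)] show ?case by blast
next
  case (ExF v e \<phi>)
  have "fm_bound \<phi> \<le> r + 4" using ExF.prems by simp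
  then obtain c T where T: "poly_bounded T" and c: "decides c T (r + 4) \<phi>"
    using ExF.IH by blast
  have "poly_bounded (\<lambda>n. T (n + cost e * (n + 1) + 1))"
    by (intro poly_bounded_compose [OF T] poly_bounded_intros)
  then have "poly_bounded (\<lambda>n. (cost e * (n + 1) + 1) * (T (n + cost e * (n + 1) + 1) + 26) + (cost e + 20))"
    by (intro poly_bounded_intros)
  with decides_ExF [OF c ExF.prems] show ?case by blast
next
  case (NthF v i e \<phi>)
  have "fm_bound \<phi> \<le> r + 3" using NthF.prems by simp
  then obtain c T where T: "poly_bounded T" and c: "decides c T (r + 3) \<phi>"
    using NthF.IH by blast
  have "poly_bounded (\<lambda>n. T (n + cost e * (n + 1)))"
    by (intro poly_bounded_compose [OF T] poly_bounded_intros)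
  then have "poly_bounded
      (\<lambda>n. T (n + cost e * (n + 1)) + (cost i * (n + 1) + 1) * 9 + (cost i + cost e + 30))"
    by (intro poly_bounded_intros)
  with decides_NthF [OF c NthF.prems] show ?case by blast
qed

text \<open>One formula serves all instances, hence so do one program and one polynomial. All
  registers but the input start as \<open>Leaf\<close>, so the input size bounds them all.\<close>

theorem poly_time_decidable_fm:
  assumes "\<And>x. x \<in> X \<Longrightarrow> holds \<phi> (initial (code x)) \<longleftrightarrow> Y x"
  shows "poly_time_decidable code X Y"
proof -
  define r where "r = Suc (fm_bound \<phi>)"
  have "fm_bound \<phi> \<le> r" by (simp add: r_def)
  then obtain c T where T: "poly_bounded T" and c: "decides c T r \<phi>"
    using fm_decidable by blast
  have "poly_bounded (\<lambda>n. T n + 3)"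
    using T by (intro poly_bounded_intros)
  then obtain p where p: "\<forall>n. T n + 3 \<le> poly p n"
    unfolding poly_bounded_def by blast
  have "\<exists>t s. exec (Seq c (Assign 0 (V r))) (initial (code x)) t s \<and>
      t \<le> poly p (size (code x)) \<and> (s 0 \<noteq> Leaf \<longleftrightarrow> Y x)" if "x \<in> X" for x
  proof -
    have "\<forall>i<r. size (initial (code x) i) \<le> size (code x)"
      by (simp add: initial_def)
    then have "runs c (initial (code x)) (T (size (code x)))
        (\<lambda>s'. (s' r \<noteq> Leaf \<longleftrightarrow> holds \<phi> (initial (code x))) \<and> (\<forall>i<r. s' i = initial (code x) i))"
      using c unfolding decides_def by blast
    then have "runs c (initial (code x)) (T (size (code x)))
        (\<lambda>s'. runs (Assign 0 (V r)) s' 2 (\<lambda>s. s 0 \<noteq> Leaf \<longleftrightarrow> Y x))"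
      using assms [OF that] by (auto elim!: runs_mono simp: runs_simps)
    then have "runs (Seq c (Assign 0 (V r))) (initial (code x)) (poly p (size (code x)))
        (\<lambda>s. s 0 \<noteq> Leaf \<longleftrightarrow> Y x)"
      by (rule runs_SeqI) (use p [rule_format, of "size (code x)"] in simp)
    then show ?thesis unfolding runs_def by blast
  qed
  then show ?thesis unfolding poly_time_decidable_def by blast
qed

section \<open>The most specific guarded clause\<close>

text \<open>A lone clause meets no opposing one: giving every relation the constant truth value
  \<open>pos L\<close> makes \<open>L\<close> true under all assignments.\<close>

lemma consistent_singleton:
  assumes "H \<noteq> {}"
  shows "consistent {H}"
proof -
  obtain L where L: "L \<in> H" using assms by blast
  show ?thesis unfolding consistent_def
    by (rule exI [of _ UNIV], rule exI [of _ "\<lambda>_ _. 0"], rule exI [of _ "\<lambda>_ _. pos L"])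
      (use L in \<open>auto simp: lit_true_def\<close>)
qed

lemma guarded_consistent: "guarded H \<Longrightarrow> consistent {H}"
  by (rule consistent_singleton) (auto simp: guarded_def)

lemma signed_rel_subst_lit [simp]: "signed_rel (subst_lit \<theta> L) = signed_rel L"
  by (simp add: signed_rel_def subst_lit_def)

lemma args_subst_lit [simp]: "args (subst_lit \<theta> L) = map (subst_trm \<theta>) (args L)"
  by (simp add: subst_lit_def)

lemma literal_eqI:
  assumes "signed_rel K = signed_rel L" "\<And>i. i < length (args L) \<Longrightarrow> args K ! i = args L ! i"
  shows "K = L"
  using assms by (cases K; cases L) (auto simp: signed_rel_def intro: nth_equalityI)

lemma signed_rel_length: "signed_rel K = signed_rel L \<Longrightarrow> length (args K) = length (args L)"
  by (simp add: signed_rel_def)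

text \<open>In the following definitions \<open>\<C>\<close> is the set of positive examples. The argument position \<open>i\<close> of
  a signed relation name determines a column of terms, one for each positive example.\<close>

definition common :: "clause set \<Rightarrow> literal \<Rightarrow> bool" where
  "common \<C> A \<longleftrightarrow> (\<forall>C\<in>\<C>. \<exists>A'\<in>C. signed_rel A' = signed_rel A)"

text \<open>The universal form avoids choosing "the" literal of a given signed relation name:
  straightness makes it unique, and \<open>common\<close> makes it exist.\<close>

definition same_column :: "clause set \<Rightarrow> literal \<Rightarrow> nat \<Rightarrow> literal \<Rightarrow> nat \<Rightarrow> bool" where
  "same_column \<C> A i B j \<longleftrightarrow> (\<forall>C\<in>\<C>. \<forall>A'\<in>C. \<forall>B'\<in>C.
     signed_rel A' = signed_rel A \<and> signed_rel B' = signed_rel B \<longrightarrow> args A' ! i = args B' ! j)"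

definition is_constant :: "trm \<Rightarrow> bool" where
  "is_constant t \<longleftrightarrow> (\<exists>c. t = Fun c [])"

text \<open>A column may repeat one compound ground term throughout. Function-freeness forbids
  keeping that term, so only a constant symbol counts here.\<close>

definition constant_column :: "clause set \<Rightarrow> literal \<Rightarrow> nat \<Rightarrow> bool" where
  "constant_column \<C> B j \<longleftrightarrow> is_constant (args B ! j) \<and> (\<forall>C\<in>\<C>. \<forall>B'\<in>C.
     signed_rel B' = signed_rel B \<longrightarrow> args B' ! j = args B ! j)"

lemma common_obtain:
  assumes "common \<C> A" "C \<in> \<C>"
  obtains A' where "A' \<in> C" "signed_rel A' = signed_rel A"
  using assms by (auto simp: common_def)

lemma same_columnD:
  assumes "same_column \<C> A i B j" "C \<in> \<C>" "A' \<in> C" "B' \<in> C"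
    "signed_rel A' = signed_rel A" "signed_rel B' = signed_rel B"
  shows "args A' ! i = args B' ! j"
  using assms(1) [unfolded same_column_def, rule_format, OF assms(2-4) conjI [OF assms(5,6)]] .

lemma constant_columnD:
  assumes "constant_column \<C> B j" "C \<in> \<C>" "B' \<in> C" "signed_rel B' = signed_rel B"
  shows "args B' ! j = args B ! j"
  using assms(1) [unfolded constant_column_def, THEN conjunct2, rule_format, OF assms(2-4)] .

lemma constant_column_is_constant: "constant_column \<C> B j \<Longrightarrow> is_constant (args B ! j)"
  unfolding constant_column_def by (rule conjunct1)

definition covered :: "clause set \<Rightarrow> literal \<Rightarrow> literal \<Rightarrow> bool" where
  "covered \<C> A B \<longleftrightarrow> common \<C> B \<and> (\<forall>j<length (args B).
     constant_column \<C> B j \<or> (\<exists>i<length (args A). same_column \<C> A i B j))"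

text \<open>Expresses without substitutions that \<open>B'\<close> is the image of the generalized
  \<open>B\<close> when the generalized guard is sent to \<open>A'\<close>.\<close>

definition matches :: "clause set \<Rightarrow> literal \<Rightarrow> literal \<Rightarrow> literal \<Rightarrow> literal \<Rightarrow> bool" where
  "matches \<C> A A' B B' \<longleftrightarrow> signed_rel B' = signed_rel B \<and> (\<forall>j<length (args B).
     (constant_column \<C> B j \<longrightarrow> args B' ! j = args B ! j) \<and>
     (\<forall>i<length (args A). same_column \<C> A i B j \<longrightarrow> args B' ! j = args A' ! i))"

lemma constant_columnI:
  assumes "args B ! j = Fun c []"
    "\<And>C B'. C \<in> \<C> \<Longrightarrow> B' \<in> C \<Longrightarrow> signed_rel B' = signed_rel B \<Longrightarrow> args B' ! j = Fun c []"
  shows "constant_column \<C> B j"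
  unfolding constant_column_def is_constant_def assms(1) using assms(2) by blast

lemma matches_constantD:
  assumes "matches \<C> A A' B B'" "j < length (args B)" "constant_column \<C> B j"
  shows "args B' ! j = args B ! j"
  using assms unfolding matches_def by blast

lemma matches_columnD:
  assumes "matches \<C> A A' B B'" "j < length (args B)" "i < length (args A)" "same_column \<C> A i B j"
  shows "args B' ! j = args A' ! i"
  using assms unfolding matches_def by blast

text \<open>The instance \<open>B = A\<close> checks \<open>A'\<close> itself: by reflexivity of
  columns it forces \<open>B' = A'\<close>, and then \<open>A'\<close> must respect the constants
  and the repeated columns of the guard.\<close>

definition guard_subsumes :: "clause set \<Rightarrow> clause \<Rightarrow> literal \<Rightarrow> clause \<Rightarrow> bool" where
  "guard_subsumes \<C> C A D \<longleftrightarrow> (\<exists>A'\<in>D. signed_rel A' = signed_rel A \<and>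
     (\<forall>B\<in>C. covered \<C> A B \<longrightarrow> (\<exists>B'\<in>D. matches \<C> A A' B B')))"

text \<open>Unary names let a substitution recover the guard position as the length of the
  variable.\<close>

definition lgg_name :: "nat \<Rightarrow> name" where
  "lgg_name i = replicate i True"

lemma lgg_name_eq [simp]: "lgg_name i = lgg_name j \<longleftrightarrow> i = j"
  by (auto simp: lgg_name_def replicate_eq_replicate)

text \<open>A variable is named after the first guard position with the same column, so equal
  columns share a variable. For covered literals such a position exists whenever the column is not
  constant.\<close>

definition lgg_trm :: "clause set \<Rightarrow> literal \<Rightarrow> literal \<Rightarrow> nat \<Rightarrow> trm" where
  "lgg_trm \<C> A B j = (if constant_column \<C> B j then args B ! j
     else Var (lgg_name (LEAST i. i < length (args A) \<and> same_column \<C> A i B j)))"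

lemma lgg_trm_constant:
  assumes "constant_column \<C> B j"
  obtains c where "args B ! j = Fun c []" "lgg_trm \<C> A B j = Fun c []"
  using constant_column_is_constant [OF assms] assms by (auto simp: is_constant_def lgg_trm_def)

definition lgg_lit :: "clause set \<Rightarrow> literal \<Rightarrow> literal \<Rightarrow> literal" where
  "lgg_lit \<C> A B = Lit (pos B) (rel B) (map (lgg_trm \<C> A B) [0..<length (args B)])"

text \<open>Literals of one positive example \<open>C\<close> suffice as representatives, since a
  signed relation name common to all examples occurs in \<open>C\<close>.\<close>

definition lgg_clause :: "clause set \<Rightarrow> clause \<Rightarrow> literal \<Rightarrow> clause" where
  "lgg_clause \<C> C A = lgg_lit \<C> A ` {B\<in>C. covered \<C> A B}"

lemma signed_rel_lgg_lit [simp]: "signed_rel (lgg_lit \<C> A B) = signed_rel B"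
  by (simp add: signed_rel_def lgg_lit_def)

lemma args_lgg_lit [simp]: "args (lgg_lit \<C> A B) = map (lgg_trm \<C> A B) [0..<length (args B)]"
  by (simp add: lgg_lit_def)

section \<open>The candidate is admissible and most specific\<close>

locale straight_examples =
  fixes \<C> :: "clause set"
  assumes straight: "C \<in> \<C> \<Longrightarrow> straight C"
begin

lemma unique: "C \<in> \<C> \<Longrightarrow> K \<in> C \<Longrightarrow> L \<in> C \<Longrightarrow> signed_rel K = signed_rel L \<Longrightarrow> K = L"
  using straight unfolding straight_def inj_on_def by blast

lemma same_column_refl: "same_column \<C> A i A i"
  unfolding same_column_def by (metis unique)

text \<open>Both cases of \<open>lgg_trm\<close> depend only on the column. Transitivity of column
  equality passes through a literal in each example, which \<open>common\<close> supplies; otherwise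
  the universal definition could hold vacuously.\<close>

lemma same_column_lgg_trm:
  assumes A: "C \<in> \<C>" "A \<in> C" "common \<C> A" and B: "B \<in> C" "common \<C> B"
    and col: "same_column \<C> A i B j"
  shows "lgg_trm \<C> A A i = lgg_trm \<C> A B j"
proof -
  note colD = same_columnD [OF col]
  have eq: "args A ! i = args B ! j"
    using colD [OF A(1,2) B(1)] by simp
  have const: "constant_column \<C> A i \<longleftrightarrow> constant_column \<C> B j"
  proof
    assume *: "constant_column \<C> A i"
    have "args L ! j = args B ! j" if L: "D \<in> \<C>" "L \<in> D" "signed_rel L = signed_rel B" for D L
    proof -
      obtain K where K: "K \<in> D" "signed_rel K = signed_rel A"
        using A(3) L(1) by (rule common_obtain)
      show ?thesis
        using constant_columnD [OF * L(1) K] colD [OF L(1) K(1) L(2) K(2) L(3)] eq by simp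
    qed
    with constant_column_is_constant [OF *] show "constant_column \<C> B j"
      unfolding constant_column_def eq by blast
  next
    assume *: "constant_column \<C> B j"
    have "args K ! i = args A ! i" if K: "D \<in> \<C>" "K \<in> D" "signed_rel K = signed_rel A" for D K
    proof -
      obtain L where L: "L \<in> D" "signed_rel L = signed_rel B"
        using B(2) K(1) by (rule common_obtain)
      show ?thesis
        using constant_columnD [OF * K(1) L] colD [OF K(1,2) L(1) K(3) L(2)] eq by simp
    qed
    with constant_column_is_constant [OF *] show "constant_column \<C> A i"
      unfolding constant_column_def eq by blast
  qed
  have "same_column \<C> A k A i \<longleftrightarrow> same_column \<C> A k B j" for k
  proof
    assume *: "same_column \<C> A k A i"
    show "same_column \<C> A k B j"
      unfolding same_column_def
    proof (intro ballI impI, elim conjE)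
      fix D K L
      assume D: "D \<in> \<C>" "K \<in> D" "L \<in> D" "signed_rel K = signed_rel A" "signed_rel L = signed_rel B"
      show "args K ! k = args L ! j"
        using same_columnD [OF * D(1,2,2,4,4)] colD [OF D] by simp
    qed
  next
    assume *: "same_column \<C> A k B j"
    show "same_column \<C> A k A i"
      unfolding same_column_def
    proof (intro ballI impI, elim conjE)
      fix D K K'
      assume D: "D \<in> \<C>" "K \<in> D" "K' \<in> D" "signed_rel K = signed_rel A" "signed_rel K' = signed_rel A"
      obtain L where L: "L \<in> D" "signed_rel L = signed_rel B"
        using B(2) D(1) by (rule common_obtain)
      show "args K ! k = args K' ! i"
        using same_columnD [OF * D(1,2) L(1) D(4) L(2)] colD [OF D(1,3) L(1) D(5) L(2)] by simp
    qed
  qed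
  with const eq show ?thesis by (simp add: lgg_trm_def)
qed

lemma covered_self: "common \<C> A \<Longrightarrow> covered \<C> A A"
  unfolding covered_def using same_column_refl by blast

text \<open>A variable comes from a non-constant column, which by coverage equals some guard column
  and hence carries the same generalized term there.\<close>

lemma guarded_lgg_clause:
  assumes A: "C \<in> \<C>" "A \<in> C" "common \<C> A"
  shows "guarded (lgg_clause \<C> C A)"
proof -
  have "lgg_lit \<C> A A \<in> lgg_clause \<C> C A"
    using A covered_self by (auto simp: lgg_clause_def)
  moreover have "lit_vars (lgg_lit \<C> A B) \<subseteq> lit_vars (lgg_lit \<C> A A)"
    if B: "B \<in> C" "covered \<C> A B" for B
  proof
    fix x assume "x \<in> lit_vars (lgg_lit \<C> A B)"
    then obtain j where j: "j < length (args B)" "x \<in> trm_vars (lgg_trm \<C> A B j)"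
      by (auto simp: lit_vars_def)
    then have "\<not> constant_column \<C> B j"
      by (auto elim: lgg_trm_constant [of \<C> B j A])
    then obtain i where i: "i < length (args A)" "same_column \<C> A i B j"
      using B(2) j(1) unfolding covered_def by blast
    moreover have "lgg_trm \<C> A A i = lgg_trm \<C> A B j"
      using A B i(2) by (intro same_column_lgg_trm) (auto simp: covered_def)
    ultimately show "x \<in> lit_vars (lgg_lit \<C> A A)"
      using j(2) by (auto simp: lit_vars_def intro!: bexI [of _ i])
  qed
  ultimately show ?thesis
    unfolding guarded_def clause_vars_def by (fastforce simp: lgg_clause_def)
qed

lemma function_free_lgg_clause: "function_free (lgg_clause \<C> C A)"
proof -
  have "function_free_trm (lgg_trm \<C> A B j)" for B j
  proof (cases "constant_column \<C> B j")
    case True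
    then show ?thesis by (rule lgg_trm_constant [of \<C> B j A]) simp
  qed (simp add: lgg_trm_def)
  then show ?thesis by (auto simp: function_free_def lgg_clause_def)
qed

lemma lgg_clause_subsumes:
  assumes A: "common \<C> A" and D: "D \<in> \<C>"
  shows "lgg_clause \<C> C A \<turnstile> D"
proof -
  obtain A' where A': "A' \<in> D" "signed_rel A' = signed_rel A"
    using A D by (rule common_obtain)
  obtain \<theta> :: "name \<Rightarrow> trm" where \<theta>: "\<And>i. \<theta> (lgg_name i) = args A' ! i"
    using that [of "\<lambda>x. args A' ! length x"] by (simp add: lgg_name_def)
  have "subst_lit \<theta> (lgg_lit \<C> A B) \<in> D" if B: "covered \<C> A B" for B
  proof -
    obtain B' where B': "B' \<in> D" "signed_rel B' = signed_rel B"
      using B [unfolded covered_def] D by (blast elim: common_obtain)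
    have "subst_lit \<theta> (lgg_lit \<C> A B) = B'"
    proof (rule literal_eqI)
      fix j assume "j < length (args B')"
      then have j: "j < length (args B)" using B'(2) signed_rel_length by metis
      have "subst_trm \<theta> (lgg_trm \<C> A B j) = args B' ! j"
      proof (cases "constant_column \<C> B j")
        case True
        then show ?thesis
          using constant_columnD [OF True D B'] by (auto elim: lgg_trm_constant [of \<C> B j A])
      next
        case False
        define i where "i = (LEAST i. i < length (args A) \<and> same_column \<C> A i B j)"
        have "\<exists>i. i < length (args A) \<and> same_column \<C> A i B j"
          using False B j unfolding covered_def by blast
        then have "same_column \<C> A i B j"
          unfolding i_def by (rule LeastI2_ex) simp
        then have "args A' ! i = args B' ! j"
          using D A'(1) B'(1) A'(2) B'(2) by (rule same_columnD)
        with False show ?thesis by (simp add: lgg_trm_def \<theta> flip: i_def)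
      qed
      with j show "args (subst_lit \<theta> (lgg_lit \<C> A B)) ! j = args B' ! j" by simp
    qed (simp add: B')
    with B'(1) show ?thesis by simp
  qed
  then show ?thesis unfolding subsumes_def lgg_clause_def by blast
qed

text \<open>The image of the generalized guard serves as \<open>A'\<close>. Equal columns carry the
  same term, so a substitution gives them equal images.\<close>

lemma lgg_clause_subsumesD:
  assumes A: "C \<in> \<C>" "A \<in> C" "common \<C> A" and sub: "lgg_clause \<C> C A \<turnstile> D"
  shows "guard_subsumes \<C> C A D"
proof -
  obtain \<theta> where \<theta>: "\<And>B. B \<in> C \<Longrightarrow> covered \<C> A B \<Longrightarrow> subst_lit \<theta> (lgg_lit \<C> A B) \<in> D"
    using sub unfolding subsumes_def lgg_clause_def by blast
  have "matches \<C> A (subst_lit \<theta> (lgg_lit \<C> A A)) B (subst_lit \<theta> (lgg_lit \<C> A B))"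
    if B: "B \<in> C" "covered \<C> A B" for B
    unfolding matches_def
  proof (intro conjI allI impI)
    fix j assume "j < length (args B)" and const: "constant_column \<C> B j"
    obtain c where "args B ! j = Fun c []" "lgg_trm \<C> A B j = Fun c []"
      using const by (rule lgg_trm_constant)
    with \<open>j < length (args B)\<close> show "args (subst_lit \<theta> (lgg_lit \<C> A B)) ! j = args B ! j"
      by simp
  next
    fix j i assume "j < length (args B)" "i < length (args A)" and col: "same_column \<C> A i B j"
    moreover have "lgg_trm \<C> A A i = lgg_trm \<C> A B j"
      using A B col by (intro same_column_lgg_trm) (auto simp: covered_def)
    ultimately show "args (subst_lit \<theta> (lgg_lit \<C> A B)) ! j = args (subst_lit \<theta> (lgg_lit \<C> A A)) ! i"
      by simp
  qed simp
  moreover have "subst_lit \<theta> (lgg_lit \<C> A A) \<in> D"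
    using \<theta> [OF A(2) covered_self [OF A(3)]] .
  ultimately show ?thesis
    unfolding guard_subsumes_def using \<theta>
    by (intro bexI [of _ "subst_lit \<theta> (lgg_lit \<C> A A)"]) auto
qed

text \<open>This is why one candidate per guard is enough. Any solution \<open>H\<close> maps its
  guard to a literal \<open>A\<close> of \<open>C\<close> and its other literals to literals covered
  by \<open>A\<close>; the matches found in \<open>D\<close> then assemble into a substitution of
  \<open>H\<close> into \<open>D\<close>.\<close>

lemma guard_subsumes_complete:
  assumes H: "function_free H" "guarded H" "\<And>D. D \<in> \<C> \<Longrightarrow> H \<turnstile> D" and C: "C \<in> \<C>"
  shows "\<exists>A\<in>C. common \<C> A \<and> (\<forall>D. guard_subsumes \<C> C A D \<longrightarrow> H \<turnstile> D)"
proof -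
  obtain G where G: "G \<in> H" "\<And>L. L \<in> H \<Longrightarrow> lit_vars L \<subseteq> lit_vars G"
    using H(2) unfolding guarded_def clause_vars_def by blast
  obtain \<theta> where \<theta>: "\<And>D L. D \<in> \<C> \<Longrightarrow> L \<in> H \<Longrightarrow> subst_lit (\<theta> D) L \<in> D"
  proof -
    have "\<forall>D\<in>\<C>. \<exists>\<theta>. subst_lit \<theta> ` H \<subseteq> D"
      using H(3) unfolding subsumes_def by blast
    then obtain \<theta> where "\<forall>D\<in>\<C>. subst_lit (\<theta> D) ` H \<subseteq> D"
      unfolding bchoice_iff by blast
    then show thesis by (intro that [of \<theta>]) blast
  qed
  \<comment> \<open>Straightness forces the image of \<open>L\<close> to be the only literal of
    \<open>D\<close> with its signed relation name.\<close>
  have lift: "K = subst_lit (\<theta> D) L"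
    if "D \<in> \<C>" "L \<in> H" "K \<in> D" "signed_rel K = signed_rel L" for D K L
    using that \<theta> by (intro unique) auto
  \<comment> \<open>Since the guard is function-free, a variable occurring in it is a whole argument
    of it and thus has a position.\<close>
  have arg: "(\<exists>c. args L ! j = Fun c []) \<or> (\<exists>i<length (args G). args G ! i = args L ! j \<and> (\<exists>x. args L ! j = Var x))"
    if L: "L \<in> H" "j < length (args L)" for L j
  proof (cases "args L ! j")
    case (Fun c ts)
    have "args L ! j \<in> set (args L)" using L(2) by simp
    then have "function_free_trm (args L ! j)"
      using H(1) L(1) unfolding function_free_def by blast
    with Fun show ?thesis by simp
  next
    case (Var x)
    have "args L ! j \<in> set (args L)" using L(2) by simp
    with Var have "x \<in> lit_vars L" unfolding lit_vars_def by fastforce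
    then obtain t where t: "t \<in> set (args G)" "x \<in> trm_vars t"
      using G(2) [OF L(1)] unfolding lit_vars_def by blast
    moreover have "function_free_trm t"
      using H(1) G(1) t(1) unfolding function_free_def by blast
    ultimately have "t = Var x" using t(2) by (cases t rule: trm.exhaust) simp_all
    with t(1) Var show ?thesis by (auto simp: in_set_conv_nth)
  qed
  define A where "A = subst_lit (\<theta> C) G"
  have sigA: "signed_rel A = signed_rel G" and lenA: "length (args A) = length (args G)"
    by (simp_all add: A_def)
  have "common \<C> A"
    unfolding common_def sigA using \<theta> G(1) by (metis signed_rel_subst_lit)
  moreover have "H \<turnstile> D" if D: "guard_subsumes \<C> C A D" for D
  proof -
    obtain A' where A': "A' \<in> D" "signed_rel A' = signed_rel A"
      and match: "\<And>B. B \<in> C \<Longrightarrow> covered \<C> A B \<Longrightarrow> \<exists>B'\<in>D. matches \<C> A A' B B'"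
      using D unfolding guard_subsumes_def by blast
    \<comment> \<open>Any guard position of \<open>x\<close> will do: its column equals that of each
      occurrence of \<open>x\<close> in \<open>H\<close>, and \<open>matches\<close> demands
      agreement with every such position.\<close>
    define pos_of where "pos_of x = (SOME i. i < length (args G) \<and> args G ! i = Var x)" for x
    define \<sigma> where "\<sigma> x = args A' ! pos_of x" for x
    have "subst_lit \<sigma> L \<in> D" if L: "L \<in> H" for L
    proof -
      define B where "B = subst_lit (\<theta> C) L"
      have sigB: "signed_rel B = signed_rel L" and lenB: "length (args B) = length (args L)"
        by (simp_all add: B_def)
      have const: "constant_column \<C> B j" and Bj: "args B ! j = Fun c []"
        if "j < length (args L)" "args L ! j = Fun c []" for j c
      proof -
        show Bj: "args B ! j = Fun c []" using that by (simp add: B_def)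
        have "args K ! j = Fun c []" if "E \<in> \<C>" "K \<in> E" "signed_rel K = signed_rel B" for E K
          using lift [OF that(1) L that(2)] that(3) sigB \<open>j < _\<close> \<open>args L ! j = _\<close> by simp
        with Bj show "constant_column \<C> B j" by (rule constant_columnI)
      qed
      have col: "same_column \<C> A i B j"
        if "i < length (args G)" "j < length (args L)" "args G ! i = args L ! j" for i j
        unfolding same_column_def
      proof (intro ballI impI)
        fix E K K'
        assume E: "E \<in> \<C>" "K \<in> E" "K' \<in> E" "signed_rel K = signed_rel A \<and> signed_rel K' = signed_rel B"
        have "K = subst_lit (\<theta> E) G" "K' = subst_lit (\<theta> E) L"
          using E L G(1) sigA sigB by (auto intro!: lift)
        with that show "args K ! i = args K' ! j" by simp
      qed
      have "common \<C> B"
        unfolding common_def sigB using \<theta> L by (metis signed_rel_subst_lit)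
      moreover have "constant_column \<C> B j \<or> (\<exists>i<length (args A). same_column \<C> A i B j)"
        if "j < length (args B)" for j
        using arg [OF L, of j] that const [of j] col [of _ j] unfolding lenA lenB by blast
      ultimately have "covered \<C> A B" unfolding covered_def by blast
      moreover have "B \<in> C" using \<theta> [OF C L] by (simp add: B_def)
      ultimately obtain B' where B': "B' \<in> D" "matches \<C> A A' B B'"
        using match by blast
      have sigB': "signed_rel B' = signed_rel B"
        using B'(2) by (simp add: matches_def)
      have "subst_lit \<sigma> L = B'"
      proof (rule literal_eqI)
        fix j assume "j < length (args B')"
        then have j: "j < length (args L)" using sigB' sigB signed_rel_length by metis
        have "subst_trm \<sigma> (args L ! j) = args B' ! j"
          using arg [OF L j]
        proof (elim disjE exE conjE)
          fix c assume c: "args L ! j = Fun c []"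
          then have "args B' ! j = args B ! j"
            using const [OF j c] B'(2) j lenB by (intro matches_constantD) simp_all
          with Bj [OF j c] c show ?thesis by simp
        next
          fix i x assume i: "i < length (args G)" "args G ! i = args L ! j" and x: "args L ! j = Var x"
          have px: "pos_of x < length (args G) \<and> args G ! pos_of x = Var x"
            unfolding pos_of_def by (rule someI [of _ i]) (use i x in simp)
          have "args B' ! j = args A' ! pos_of x"
            by (rule matches_columnD [OF B'(2)]) (use px j x lenA lenB col in simp_all)
          with x show ?thesis by (simp add: \<sigma>_def)
        qed
        with j show "args (subst_lit \<sigma> L) ! j = args B' ! j" by simp
      qed (simp add: sigB' sigB)
      with B'(1) show ?thesis by simp
    qed
    then show ?thesis unfolding subsumes_def by blast
  qed
  moreover have "A \<in> C" using \<theta> [OF C G(1)] by (simp add: A_def)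
  ultimately show ?thesis by blast
qed

end

text \<open>Settles the instances without positive examples. Having no arguments makes the unit
  clause trivially guarded and function-free.\<close>

lemma ex_fresh_unit_clause:
  assumes "finite En" "\<And>C. C \<in> En \<Longrightarrow> finite C"
  shows "\<exists>L. args L = [] \<and> (\<forall>C\<in>En. \<not> {L} \<turnstile> C)"
proof -
  have "finite (rel ` \<Union> En)"
    using assms by blast
  moreover have "infinite (UNIV :: name set)"
    by (rule infinite_UNIV_listI)
  ultimately obtain r where "r \<notin> rel ` \<Union> En"
    using ex_new_if_finite by blast
  then show ?thesis
    by (intro exI [of _ "Lit True r []"]) (force simp: subsumes_def subst_lit_def)
qed

theorem ilp_consistent_iff:
  assumes "ilp_instance Ep En"
  shows "ilp_consistent Ep En \<longleftrightarrow> Ep = {} \<or>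
    (\<exists>C\<in>Ep. \<exists>A\<in>C. common Ep A \<and> (\<forall>D\<in>En. \<not> guard_subsumes Ep C A D))"
proof -
  interpret straight_examples Ep
    using assms by unfold_locales (auto simp: ilp_instance_def)
  show ?thesis
  proof
    assume "ilp_consistent Ep En"
    then obtain H where H: "function_free H" "guarded H" "\<forall>C\<in>Ep. H \<turnstile> C" "\<forall>C\<in>En. \<not> H \<turnstile> C"
      unfolding ilp_consistent_def by blast
    then show "Ep = {} \<or> (\<exists>C\<in>Ep. \<exists>A\<in>C. common Ep A \<and> (\<forall>D\<in>En. \<not> guard_subsumes Ep C A D))"
      using guard_subsumes_complete [of H] by (metis ex_in_conv)
  next
    assume "Ep = {} \<or> (\<exists>C\<in>Ep. \<exists>A\<in>C. common Ep A \<and> (\<forall>D\<in>En. \<not> guard_subsumes Ep C A D))"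
    then show "ilp_consistent Ep En"
    proof (elim disjE bexE conjE)
      assume "Ep = {}"
      obtain L where L: "args L = []" "\<forall>C\<in>En. \<not> {L} \<turnstile> C"
        using ex_fresh_unit_clause [of En] assms unfolding ilp_instance_def by blast
      have "function_free {L}" "guarded {L}"
        using L(1) by (simp_all add: function_free_def guarded_def clause_vars_def)
      with L(2) \<open>Ep = {}\<close> show ?thesis
        unfolding ilp_consistent_def by (intro exI [of _ "{L}"]) (simp add: guarded_consistent)
    next
      fix C A
      assume CA: "C \<in> Ep" "A \<in> C" "common Ep A" and neg: "\<forall>D\<in>En. \<not> guard_subsumes Ep C A D"
      have "finite C" using assms CA(1) by (simp add: ilp_instance_def)
      then have "finite (lgg_clause Ep C A)" by (simp add: lgg_clause_def)
      moreover have "guarded (lgg_clause Ep C A)"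
        using CA by (rule guarded_lgg_clause)
      moreover have "\<forall>D\<in>En. \<not> lgg_clause Ep C A \<turnstile> D"
        using neg lgg_clause_subsumesD [OF CA] by blast
      ultimately show ?thesis
        unfolding ilp_consistent_def
        using CA(3) by (intro exI [of _ "lgg_clause Ep C A"])
          (simp add: function_free_lgg_clause lgg_clause_subsumes guarded_consistent)
    qed
  qed
qed

section \<open>The criterion as a formula\<close>

primrec tree_list :: "tree \<Rightarrow> tree list" where
  "tree_list Leaf = []"
| "tree_list (Node a b) = a # tree_list b"

lemma tree_list_code_list [simp]: "tree_list (code_list ts) = ts"
  by (induction ts) (simp_all add: code_list_def)

lemma length_tree_list [simp]: "length (tree_list t) = len t"
  by (induction t) simp_all

lemma len_code_list [simp]: "len (code_list ts) = length ts"
  by (metis length_tree_list tree_list_code_list)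

lemma code_list_eq_Leaf [simp]: "code_list ts = Leaf \<longleftrightarrow> ts = []"
  by (cases ts) (simp_all add: code_list_def)

lemma left_right_funpow:
  "left ((right ^^ k) t) = (if k < len t then tree_list t ! k else Leaf)"
proof (induction t arbitrary: k)
  case Leaf
  have "(right ^^ k) Leaf = Leaf" by (induction k) simp_all
  then show ?case by simp
next
  case (Node a b)
  then show ?case by (cases k) (simp_all add: funpow_swap1 del: funpow.simps(2) add: funpow_Suc_right)
qed

definition OrF :: "fm \<Rightarrow> fm \<Rightarrow> fm" where
  "OrF \<phi> \<psi> = NotF (AndF (NotF \<phi>) (NotF \<psi>))"

definition ImpF :: "fm \<Rightarrow> fm \<Rightarrow> fm" where
  "ImpF \<phi> \<psi> = NotF (AndF \<phi> (NotF \<psi>))"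

definition AllIndexF :: "nat \<Rightarrow> expr \<Rightarrow> fm \<Rightarrow> fm" where
  "AllIndexF v e \<phi> = NotF (ExF v e (NotF \<phi>))"

text \<open>Register \<open>v\<close> holds first the index and then the element itself. The list is
  read again after \<open>v\<close> has changed, whence the assumption on \<open>e\<close> in
  \<open>holds_ExElemF\<close>.\<close>

definition ExElemF :: "nat \<Rightarrow> expr \<Rightarrow> fm \<Rightarrow> fm" where
  "ExElemF v e \<phi> = ExF v e (NthF v (V v) e \<phi>)"

definition AllElemF :: "nat \<Rightarrow> expr \<Rightarrow> fm \<Rightarrow> fm" where
  "AllElemF v e \<phi> = NotF (ExElemF v e (NotF \<phi>))"

lemma holds_OrF [simp]: "holds (OrF \<phi> \<psi>) s \<longleftrightarrow> holds \<phi> s \<or> holds \<psi> s"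
  by (auto simp: OrF_def)

lemma holds_ImpF [simp]: "holds (ImpF \<phi> \<psi>) s \<longleftrightarrow> (holds \<phi> s \<longrightarrow> holds \<psi> s)"
  by (auto simp: ImpF_def)

lemma holds_AllIndexF [simp]:
  "holds (AllIndexF v e \<phi>) s \<longleftrightarrow> (\<forall>k<len (eval_expr e s). holds \<phi> (s(v := unary k)))"
  by (auto simp: AllIndexF_def)

lemma holds_ExElemF:
  assumes "\<And>t. eval_expr e (s(v := t)) = eval_expr e s"
  shows "holds (ExElemF v e \<phi>) s \<longleftrightarrow> (\<exists>t\<in>set (tree_list (eval_expr e s)). holds \<phi> (s(v := t)))"
  using assms by (force simp: ExElemF_def left_right_funpow in_set_conv_nth)

lemma holds_AllElemF:
  assumes "\<And>t. eval_expr e (s(v := t)) = eval_expr e s"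
  shows "holds (AllElemF v e \<phi>) s \<longleftrightarrow> (\<forall>t\<in>set (tree_list (eval_expr e s)). holds \<phi> (s(v := t)))"
  using assms by (simp add: AllElemF_def holds_ExElemF)

section \<open>Formulas for the notions of the criterion\<close>

abbreviation args_expr :: "nat \<Rightarrow> expr" where
  "args_expr a \<equiv> TlE (TlE (V a))"

definition code_clause :: "literal list \<Rightarrow> tree" where
  "code_clause C = code_list (map code_lit C)"

lemma code_trm_neq_Leaf [simp]: "code_trm t \<noteq> Leaf"
  by (cases t) simp_all

lemma left_right_funpow_code:
  "i < length ts \<Longrightarrow> left ((right ^^ i) (code_list (map code_trm ts))) = code_trm (ts ! i)"
  by (simp add: left_right_funpow)

text \<open>Arities are compared by reading one argument list at the length of the other. Codes of
  terms are never \<open>Leaf\<close>, so finding \<open>Leaf\<close> means that the list is no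
  longer than the other; both directions give equality.\<close>

definition same_rel_fm :: "nat \<Rightarrow> nat \<Rightarrow> fm" where
  "same_rel_fm a b =
     AndF (EqF (HdE (V a)) (HdE (V b)))
    (AndF (EqF (HdE (TlE (V a))) (HdE (TlE (V b))))
    (AndF (NthF 14 (args_expr a) (args_expr b) (EqF (V 14) NilE))
          (NthF 14 (args_expr b) (args_expr a) (EqF (V 14) NilE))))"

lemma holds_same_rel_fm:
  assumes "s a = code_lit A" "s b = code_lit B"
  shows "holds (same_rel_fm a b) s \<longleftrightarrow> signed_rel A = signed_rel B"
  using assms
  by (auto simp: same_rel_fm_def code_lit_def signed_rel_def left_right_funpow
      inj_eq [OF inj_code_bool] inj_eq [OF inj_code_name] split: if_splits)

definition same_arg_fm :: "nat \<Rightarrow> nat \<Rightarrow> nat \<Rightarrow> nat \<Rightarrow> fm" where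
  "same_arg_fm a i b j =
     NthF 12 (V i) (args_expr a) (NthF 13 (V j) (args_expr b) (EqF (V 12) (V 13)))"

text \<open>Register 12 is overwritten before \<open>b\<close> and \<open>j\<close> are read, which
  explains the bounds on these two registers.\<close>

lemma holds_same_arg_fm:
  assumes "s a = code_lit A" "s i = unary m" "s b = code_lit B" "s j = unary n"
    and "m < length (args A)" "n < length (args B)" and "b < 12" "j < 12"
  shows "holds (same_arg_fm a i b j) s \<longleftrightarrow> args A ! m = args B ! n"
  using assms
  by (simp add: same_arg_fm_def code_lit_def left_right_funpow_code inj_eq [OF inj_code_trm])

text \<open>Registers: 0 the instance, 1 the positive example whose literals serve as representatives of the
  signed relation names, 2 the guard, 3 the negative example, 4 the image of the guard, 5 another
  literal of 1, 6 its image, 7 and 8 argument positions of 5 and 2; 9 to 14 are local.\<close>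

definition common_fm :: "nat \<Rightarrow> fm" where
  "common_fm a = AllElemF 9 (HdE (V 0)) (ExElemF 10 (V 9) (same_rel_fm 10 a))"

definition same_column_fm :: fm where
  "same_column_fm =
     AllElemF 9 (HdE (V 0)) (AllElemF 10 (V 9) (AllElemF 11 (V 9)
       (ImpF (AndF (same_rel_fm 10 2) (same_rel_fm 11 5)) (same_arg_fm 10 8 11 7))))"

definition constant_column_fm :: fm where
  "constant_column_fm =
     AndF (NthF 12 (V 7) (args_expr 5)
       (AndF (NotF (EqF (HdE (V 12)) NilE)) (EqF (TlE (TlE (V 12))) NilE)))
     (AllElemF 9 (HdE (V 0)) (AllElemF 10 (V 9)
       (ImpF (same_rel_fm 10 5) (same_arg_fm 10 7 5 7))))"

definition covered_fm :: fm where
  "covered_fm = AndF (common_fm 5)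
     (AllIndexF 7 (args_expr 5) (OrF constant_column_fm (ExF 8 (args_expr 2) same_column_fm)))"

definition matches_fm :: fm where
  "matches_fm = AndF (same_rel_fm 6 5) (AllIndexF 7 (args_expr 5)
     (AndF (ImpF constant_column_fm (same_arg_fm 6 7 5 7))
       (AllIndexF 8 (args_expr 2) (ImpF same_column_fm (same_arg_fm 6 7 4 8)))))"

definition guard_subsumes_fm :: fm where
  "guard_subsumes_fm = ExElemF 4 (V 3) (AndF (same_rel_fm 4 2)
     (AllElemF 5 (V 1) (ImpF covered_fm (ExElemF 6 (V 3) matches_fm))))"

definition ilp_fm :: fm where
  "ilp_fm = OrF (EqF (HdE (V 0)) NilE)
     (ExElemF 1 (HdE (V 0)) (ExElemF 2 (V 1) (AndF (common_fm 2)
       (AllElemF 3 (TlE (V 0)) (NotF guard_subsumes_fm)))))"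

section \<open>Meaning of the formulas on coded instances\<close>

context
  fixes Ps :: "literal list list"
begin

lemma eval_positive:
  assumes "left (s 0) = code_clauses Ps"
  shows "tree_list (eval_expr (HdE (V 0)) s) = map code_clause Ps"
  using assms by (simp add: code_clauses_def code_clause_def)

lemma tree_list_code_clause [simp]: "tree_list (code_clause C) = map code_lit C"
  by (simp add: code_clause_def)

lemma holds_common_fm:
  assumes "left (s 0) = code_clauses Ps" "s a = code_lit A" "a < 9"
  shows "holds (common_fm a) s \<longleftrightarrow> common (clauses Ps) A"
proof -
  have "holds (same_rel_fm 10 a) (s(9 := t, 10 := code_lit A')) \<longleftrightarrow> signed_rel A' = signed_rel A" for t A'
    using assms by (intro holds_same_rel_fm) auto
  with assms(1) show ?thesis
    by (simp add: common_fm_def common_def clauses_def holds_AllElemF holds_ExElemF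
        eval_positive del: eval_expr.simps(4))
qed

text \<open>The positions are in range for \<open>A'\<close> and \<open>B'\<close> only once the
  signed relation names agree; the congruence rules make that premise available when the argument
  test is rewritten.\<close>

lemma holds_same_column_fm:
  assumes "left (s 0) = code_clauses Ps" "s 2 = code_lit A" "s 5 = code_lit B"
    "s 8 = unary i" "s 7 = unary j" "i < length (args A)" "j < length (args B)"
  shows "holds same_column_fm s \<longleftrightarrow> same_column (clauses Ps) A i B j"
proof -
  let ?s = "\<lambda>t A' B'. s(9 := t, 10 := code_lit A', 11 := code_lit B')"
  have "holds (same_rel_fm 10 2) (?s t A' B') \<longleftrightarrow> signed_rel A' = signed_rel A"
    "holds (same_rel_fm 11 5) (?s t A' B') \<longleftrightarrow> signed_rel B' = signed_rel B" for t A' B'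
    using assms by (auto intro!: holds_same_rel_fm)
  moreover have "holds (same_arg_fm 10 8 11 7) (?s t A' B') \<longleftrightarrow> args A' ! i = args B' ! j"
    if "signed_rel A' = signed_rel A" "signed_rel B' = signed_rel B" for t A' B'
    using assms that [THEN signed_rel_length] by (intro holds_same_arg_fm) auto
  ultimately show ?thesis
    using assms(1)
    by (simp add: same_column_fm_def same_column_def clauses_def holds_AllElemF
        eval_positive del: eval_expr.simps(4) cong: conj_cong imp_cong)
qed

text \<open>The head of a code separates \<open>Fun\<close> from \<open>Var\<close>; for
  \<open>Fun\<close>, the second tail is the argument list.\<close>

lemma is_constant_code:
  "is_constant t \<longleftrightarrow> left (code_trm t) \<noteq> Leaf \<and> right (right (code_trm t)) = Leaf"
  by (cases t) (auto simp: is_constant_def code_bool_def)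

lemma holds_constant_column_fm:
  assumes "left (s 0) = code_clauses Ps" "s 5 = code_lit B" "s 7 = unary j" "j < length (args B)"
  shows "holds constant_column_fm s \<longleftrightarrow> constant_column (clauses Ps) B j"
proof -
  let ?s = "\<lambda>t B'. s(9 := t, 10 := code_lit B')"
  have "holds (same_rel_fm 10 5) (?s t B') \<longleftrightarrow> signed_rel B' = signed_rel B" for t B'
    using assms by (intro holds_same_rel_fm) auto
  moreover have "holds (same_arg_fm 10 7 5 7) (?s t B') \<longleftrightarrow> args B' ! j = args B ! j"
    if "signed_rel B' = signed_rel B" for t B'
    using assms that [THEN signed_rel_length] by (intro holds_same_arg_fm) auto
  moreover have "holds (NthF 12 (V 7) (args_expr 5)
       (AndF (NotF (EqF (HdE (V 12)) NilE)) (EqF (TlE (TlE (V 12))) NilE))) s \<longleftrightarrow> is_constant (args B ! j)"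
    using assms by (simp add: code_lit_def left_right_funpow_code is_constant_code)
  ultimately show ?thesis
    using assms(1)
    by (simp add: constant_column_fm_def constant_column_def clauses_def holds_AllElemF
        eval_positive del: eval_expr.simps(4) holds.simps(5) cong: conj_cong imp_cong)
qed

lemma len_args [simp]: "len (right (right (code_lit A))) = length (args A)"
  by (simp add: code_lit_def)

lemma holds_covered_fm:
  assumes "left (s 0) = code_clauses Ps" "s 2 = code_lit A" "s 5 = code_lit B"
  shows "holds covered_fm s \<longleftrightarrow> covered (clauses Ps) A B"
proof -
  have "holds (common_fm 5) s \<longleftrightarrow> common (clauses Ps) B"
    using assms by (intro holds_common_fm) auto
  moreover have "holds constant_column_fm (s(7 := unary j)) \<longleftrightarrow> constant_column (clauses Ps) B j"
    if "j < length (args B)" for j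
    using assms that by (intro holds_constant_column_fm) auto
  moreover have "holds same_column_fm (s(7 := unary j, 8 := unary i)) \<longleftrightarrow> same_column (clauses Ps) A i B j"
    if "j < length (args B)" "i < length (args A)" for i j
    using assms that by (intro holds_same_column_fm) auto
  ultimately show ?thesis
    using assms(2,3) by (simp add: covered_fm_def covered_def cong: conj_cong imp_cong)
qed

text \<open>Agreement of \<open>A'\<close> with \<open>A\<close> in signed relation name puts each
  guard position in range for \<open>A'\<close>.\<close>

lemma holds_matches_fm:
  assumes "left (s 0) = code_clauses Ps" "s 2 = code_lit A" "s 5 = code_lit B"
    "s 4 = code_lit A'" "s 6 = code_lit B'" "signed_rel A' = signed_rel A"
  shows "holds matches_fm s \<longleftrightarrow> matches (clauses Ps) A A' B B'"
proof -
  have "holds (same_rel_fm 6 5) s \<longleftrightarrow> signed_rel B' = signed_rel B"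
    using assms by (intro holds_same_rel_fm) auto
  moreover have "holds constant_column_fm (s(7 := unary j)) \<longleftrightarrow> constant_column (clauses Ps) B j"
    if "j < length (args B)" for j
    using assms that by (intro holds_constant_column_fm) auto
  moreover have "holds same_column_fm (s(7 := unary j, 8 := unary i)) \<longleftrightarrow> same_column (clauses Ps) A i B j"
    if "j < length (args B)" "i < length (args A)" for i j
    using assms that by (intro holds_same_column_fm) auto
  moreover have "holds (same_arg_fm 6 7 5 7) (s(7 := unary j)) \<longleftrightarrow> args B' ! j = args B ! j"
    if "j < length (args B)" "signed_rel B' = signed_rel B" for j
    using assms that signed_rel_length [OF that(2)] by (intro holds_same_arg_fm) auto
  moreover have "holds (same_arg_fm 6 7 4 8) (s(7 := unary j, 8 := unary i)) \<longleftrightarrow> args B' ! j = args A' ! i"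
    if "j < length (args B)" "i < length (args A)" "signed_rel B' = signed_rel B" for i j
    using assms that signed_rel_length [OF that(3)] signed_rel_length [OF assms(6)]
    by (intro holds_same_arg_fm) auto
  ultimately show ?thesis
    using assms(2,3) by (simp add: matches_fm_def matches_def cong: conj_cong imp_cong)
qed

lemma holds_guard_subsumes_fm:
  assumes "left (s 0) = code_clauses Ps" "s 1 = code_clause C" "s 2 = code_lit A" "s 3 = code_clause D"
  shows "holds guard_subsumes_fm s \<longleftrightarrow> guard_subsumes (clauses Ps) (set C) A (set D)"
proof -
  have "holds (same_rel_fm 4 2) (s(4 := code_lit A')) \<longleftrightarrow> signed_rel A' = signed_rel A" for A'
    using assms by (intro holds_same_rel_fm) auto
  moreover have "holds covered_fm (s(4 := t, 5 := code_lit B)) \<longleftrightarrow> covered (clauses Ps) A B" for t B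
    using assms by (intro holds_covered_fm) auto
  moreover have "holds matches_fm (s(4 := code_lit A', 5 := code_lit B, 6 := code_lit B')) \<longleftrightarrow>
      matches (clauses Ps) A A' B B'" if "signed_rel A' = signed_rel A" for A' B B'
    using assms that by (intro holds_matches_fm) auto
  ultimately show ?thesis
    using assms(2,4)
    by (simp add: guard_subsumes_fm_def guard_subsumes_def holds_AllElemF holds_ExElemF
        cong: conj_cong imp_cong)
qed

lemma holds_ilp_fm:
  "holds ilp_fm (initial (code_presentation (Ps, Ns))) \<longleftrightarrow> clauses Ps = {} \<or>
    (\<exists>C\<in>clauses Ps. \<exists>A\<in>C. common (clauses Ps) A \<and>
      (\<forall>D\<in>clauses Ns. \<not> guard_subsumes (clauses Ps) C A D))"
proof -
  define s where "s = initial (code_presentation (Ps, Ns))"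
  have s: "left (s 0) = code_clauses Ps" "right (s 0) = code_list (map code_clause Ns)"
    by (simp_all add: s_def initial_def code_presentation_def code_clauses_def code_clause_def [abs_def])
  have "holds (common_fm 2) (s(1 := t, 2 := code_lit A)) \<longleftrightarrow> common (clauses Ps) A" for t A
    using s by (intro holds_common_fm) auto
  moreover have "holds guard_subsumes_fm (s(1 := code_clause C, 2 := code_lit A, 3 := code_clause D)) \<longleftrightarrow>
      guard_subsumes (clauses Ps) (set C) A (set D)" for C A D
    using s by (intro holds_guard_subsumes_fm) auto
  moreover have "code_clauses Ps = Leaf \<longleftrightarrow> clauses Ps = {}"
    by (cases Ps) (simp_all add: code_clauses_def code_list_def clauses_def)
  moreover have "tree_list (code_clauses Ps) = map code_clause Ps"
    by (simp add: code_clauses_def code_clause_def)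
  ultimately show ?thesis
    unfolding s_def [symmetric]
    using s by (simp add: ilp_fm_def holds_AllElemF holds_ExElemF) (simp add: clauses_def)
qed

end

theorem theorem11:
  shows "poly_time_decidable code_presentation
    {(Ps, Ns). ilp_instance (clauses Ps) (clauses Ns)}
    (\<lambda>(Ps, Ns). ilp_consistent (clauses Ps) (clauses Ns))"
  by (rule poly_time_decidable_fm [where \<phi> = ilp_fm]) (auto simp: holds_ilp_fm ilp_consistent_iff)

end
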